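(* Let $\mathcal C$ be a triangulated category and let $(\mathcal D,\mathcal T)$ be a left filterable pair of $t$-structures of type $(n,0)$ on $\mathcal C$, with left basic torsion classes ${}_i\mathcal X$, $0\le i\le n-1$. The $t$-structure $\mathcal T$ is left $\mathcal D$-compatible if and only if the left basic torsion classes ${}_i\mathcal X$ lie in $\mathcal H_{\mathcal D}$; in particular (in this case) they satisfy $${}_{n-1}\mathcal X\subseteq{}_{n-2}\mathcal X\subseteq\cdots\subseteq{}_1\mathcal X\subseteq{}_0\mathcal X\subseteq\mathcal H_{\mathcal D}.$$
   Context: Full subcategories are closed under isomorphisms and additive. For a $t$-structure $\mathcal D=(\mathcal D^{\le 0},\mathcal D^{\ge 0})$ on $\mathcal C$ put $\mathcal D^{\le i}:=\mathcal D^{\le 0}[-i]$, $\mathcal D^{\ge i}:=\mathcal D^{\ge 0}[-i]$; $\mathcal D^{\le 0}$ is the aisle, $\mathcal H_{\mathcal D}=\mathcal D^{\le 0}\cap\mathcal D^{\ge 0}$ the heart; $\delta^{\le i}$ denotes the truncation functor of $\mathcal D$ (right adjoint to the inclusion $\mathcal D^{\le i}\subseteq\mathcal C$). All $t$-structures considered are non-degenerate: $\bigcap_i\mathcal D^{\le i}=0=\bigcap_i\mathcal D^{\ge i}$. A $t$-structure is determined by its aisle. $(\mathcal D,\mathcal T)$ is of type $(n,k)$ if $k\in\mathbb Z$ is maximal with $\mathcal T^{\le k}\subseteq\mathcal D^{\le 0}$ and $n\in\mathbb N$ is minimal with $\mathcal D^{\le -n}\subseteq\mathcal T^{\le k}$.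 $(\mathcal D,\mathcal T)$ is left filterable if for every $i\in\mathbb Z$ the class $\mathcal D^{\le i}\cap\mathcal T^{\le 0}$ is the aisle of a $t$-structure. For such a pair of type $(n,0)$, the left basic $t$-structure ${}_i\mathcal D$ is the $t$-structure with aisle ${}_i\mathcal D^{\le 0}=\mathcal D^{\le 0}\cap\mathcal T^{\le n-i}$, ${}_i\mathcal H$ is its heart, and the left basic torsion class ${}_i\mathcal X$ is ${}_i\mathcal X:={}_{i+1}\mathcal D^{\le 0}\cap{}_i\mathcal H$ (the torsion class of a torsion pair in ${}_i\mathcal H$). $\mathcal T$ is left $\mathcal D$-compatible if $\delta^{\le i}(\mathcal T^{\le 0})\subseteq\mathcal T^{\le 0}$ for every $i\in\mathbb Z$. *)

theory Defs
  imports "HOL-Algebra.Group"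
begin

section \<open>Categories and additive categories\<close>

record ('o, 'm) category =
  Obj :: "'o set"
  Arr :: "'m set"
  Dom :: "'m \<Rightarrow> 'o"
  Cod :: "'m \<Rightarrow> 'o"
  Id :: "'o \<Rightarrow> 'm"
  Comp :: "'m \<Rightarrow> 'm \<Rightarrow> 'm" (infixl "\<cdot>\<index>" 70)

definition Hom :: "('o, 'm, 'x) category_scheme \<Rightarrow> 'o \<Rightarrow> 'o \<Rightarrow> 'm set" where
  "Hom C X Y = {f \<in> Arr C. Dom C f = X \<and> Cod C f = Y}"

locale category =
  fixes C :: "('o, 'm, 'x) category_scheme" (structure)
  assumes Dom_Obj: "f \<in> Arr C \<Longrightarrow> Dom C f \<in> Obj C"
    and Cod_Obj: "f \<in> Arr C \<Longrightarrow> Cod C f \<in> Obj C"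
    and Id_Hom: "X \<in> Obj C \<Longrightarrow> Id C X \<in> Hom C X X"
    and Comp_Hom: "f \<in> Hom C X Y \<Longrightarrow> g \<in> Hom C Y Z \<Longrightarrow> g \<cdot> f \<in> Hom C X Z"
    and Comp_Id: "f \<in> Hom C X Y \<Longrightarrow> f \<cdot> Id C X = f"
    and Id_Comp: "f \<in> Hom C X Y \<Longrightarrow> Id C Y \<cdot> f = f"
    and Comp_assoc:
      "f \<in> Hom C W X \<Longrightarrow> g \<in> Hom C X Y \<Longrightarrow> h \<in> Hom C Y Z \<Longrightarrow> (h \<cdot> g) \<cdot> f = h \<cdot> (g \<cdot> f)"

definition is_iso :: "('o, 'm, 'x) category_scheme \<Rightarrow> 'm \<Rightarrow> bool" where
  "is_iso C f \<longleftrightarrow> f \<in> Arr C \<and>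
    (\<exists>g \<in> Hom C (Cod C f) (Dom C f).
      g \<cdot>\<^bsub>C\<^esub> f = Id C (Dom C f) \<and> f \<cdot>\<^bsub>C\<^esub> g = Id C (Cod C f))"

definition isomorphic :: "('o, 'm, 'x) category_scheme \<Rightarrow> 'o \<Rightarrow> 'o \<Rightarrow> bool" where
  "isomorphic C X Y \<longleftrightarrow> (\<exists>f \<in> Hom C X Y. is_iso C f)"

definition is_zero_object :: "('o, 'm, 'x) category_scheme \<Rightarrow> 'o \<Rightarrow> bool" where
  "is_zero_object C Z \<longleftrightarrow> Z \<in> Obj C \<and>
    (\<forall>X \<in> Obj C. (\<exists>!f. f \<in> Hom C X Z) \<and> (\<exists>!f. f \<in> Hom C Z X))"

definition endofunctor ::
  "('o, 'm, 'x) category_scheme \<Rightarrow> ('o \<Rightarrow> 'o) \<Rightarrow> ('m \<Rightarrow> 'm) \<Rightarrow> bool" where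
  "endofunctor C Fo Fa \<longleftrightarrow>
    (\<forall>X \<in> Obj C. Fo X \<in> Obj C \<and> Fa (Id C X) = Id C (Fo X)) \<and>
    (\<forall>X \<in> Obj C. \<forall>Y \<in> Obj C. \<forall>f \<in> Hom C X Y. Fa f \<in> Hom C (Fo X) (Fo Y)) \<and>
    (\<forall>X \<in> Obj C. \<forall>Y \<in> Obj C. \<forall>Z \<in> Obj C. \<forall>f \<in> Hom C X Y. \<forall>g \<in> Hom C Y Z.
      Fa (g \<cdot>\<^bsub>C\<^esub> f) = Fa g \<cdot>\<^bsub>C\<^esub> Fa f)"

record ('o, 'm) preadditive = "('o, 'm) category" +
  Add :: "'m \<Rightarrow> 'm \<Rightarrow> 'm"
  Zero :: "'o \<Rightarrow> 'o \<Rightarrow> 'm"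

definition Hom_group :: "('o, 'm, 'x) preadditive_scheme \<Rightarrow> 'o \<Rightarrow> 'o \<Rightarrow> 'm monoid" where
  "Hom_group C X Y = \<lparr>carrier = Hom C X Y, monoid.mult = Add C, one = Zero C X Y\<rparr>"

definition Neg :: "('o, 'm, 'x) preadditive_scheme \<Rightarrow> 'm \<Rightarrow> 'm" where
  "Neg C f = inv\<^bsub>Hom_group C (Dom C f) (Cod C f)\<^esub> f"

definition is_biproduct ::
  "('o, 'm, 'x) preadditive_scheme \<Rightarrow> 'o \<Rightarrow> 'o \<Rightarrow> 'o \<Rightarrow> 'm \<Rightarrow> 'm \<Rightarrow> 'm \<Rightarrow> 'm \<Rightarrow> bool" where
  "is_biproduct C X Y S i j p q \<longleftrightarrow>
    i \<in> Hom C X S \<and> j \<in> Hom C Y S \<and> p \<in> Hom C S X \<and> q \<in> Hom C S Y \<and>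
    p \<cdot>\<^bsub>C\<^esub> i = Id C X \<and> q \<cdot>\<^bsub>C\<^esub> j = Id C Y \<and>
    q \<cdot>\<^bsub>C\<^esub> i = Zero C X Y \<and> p \<cdot>\<^bsub>C\<^esub> j = Zero C Y X \<and>
    Add C (i \<cdot>\<^bsub>C\<^esub> p) (j \<cdot>\<^bsub>C\<^esub> q) = Id C S"

locale additive_category = category C
  for C :: "('o, 'm, 'x) preadditive_scheme" (structure) +
  assumes Hom_comm_group: "X \<in> Obj C \<Longrightarrow> Y \<in> Obj C \<Longrightarrow> comm_group (Hom_group C X Y)"
    and Comp_Add: "f \<in> Hom C X Y \<Longrightarrow> g \<in> Hom C Y Z \<Longrightarrow> h \<in> Hom C Y Z \<Longrightarrow>
      Add C g h \<cdot> f = Add C (g \<cdot> f) (h \<cdot> f)"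
    and Add_Comp: "f \<in> Hom C X Y \<Longrightarrow> g \<in> Hom C X Y \<Longrightarrow> h \<in> Hom C Y Z \<Longrightarrow>
      h \<cdot> Add C f g = Add C (h \<cdot> f) (h \<cdot> g)"
    and ex_zero_object: "\<exists>Z. is_zero_object C Z"
    and ex_biproduct: "X \<in> Obj C \<Longrightarrow> Y \<in> Obj C \<Longrightarrow>
      \<exists>S \<in> Obj C. \<exists>i j p q. is_biproduct C X Y S i j p q"


section \<open>Triangulated categories\<close>

text \<open>The translation functor is an automorphism of the category, as in Verdier's definition;
  it is presented by all its integer powers: \<open>ShO C n X\<close> is \<open>X[n]\<close> and \<open>ShA C n f\<close> is \<open>f[n]\<close>.
  A triple \<open>(f, g, h)\<close> stands for the triangle with consecutive arrows
  \<open>X \<rightarrow> Y \<rightarrow> Z \<rightarrow> X[1]\<close>, the objects being the domains of the arrows.\<close>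

record ('o, 'm) triangulated = "('o, 'm) preadditive" +
  ShO :: "int \<Rightarrow> 'o \<Rightarrow> 'o"
  ShA :: "int \<Rightarrow> 'm \<Rightarrow> 'm"
  Dist :: "('m \<times> 'm \<times> 'm) set"

definition is_triangle ::
  "('o, 'm, 'x) triangulated_scheme \<Rightarrow> 'm \<times> 'm \<times> 'm \<Rightarrow> bool" where
  "is_triangle C = (\<lambda>(f, g, h). f \<in> Arr C \<and> g \<in> Arr C \<and> h \<in> Arr C \<and>
    Cod C f = Dom C g \<and> Cod C g = Dom C h \<and> Cod C h = ShO C 1 (Dom C f))"

definition triangle_hom ::
  "('o, 'm, 'x) triangulated_scheme \<Rightarrow> 'm \<times> 'm \<times> 'm \<Rightarrow> 'm \<times> 'm \<times> 'm \<Rightarrow> 'm \<times> 'm \<times> 'm \<Rightarrow> bool"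
where
  "triangle_hom C = (\<lambda>(f, g, h) (f', g', h') (a, b, c).
    a \<in> Hom C (Dom C f) (Dom C f') \<and>
    b \<in> Hom C (Dom C g) (Dom C g') \<and>
    c \<in> Hom C (Dom C h) (Dom C h') \<and>
    b \<cdot>\<^bsub>C\<^esub> f = f' \<cdot>\<^bsub>C\<^esub> a \<and> c \<cdot>\<^bsub>C\<^esub> g = g' \<cdot>\<^bsub>C\<^esub> b \<and>
    ShA C 1 a \<cdot>\<^bsub>C\<^esub> h = h' \<cdot>\<^bsub>C\<^esub> c)"

locale triangulated_category = additive_category C
  for C :: "('o, 'm, 'x) triangulated_scheme" (structure) +
  assumes Sh_endofunctor: "endofunctor C (ShO C n) (ShA C n)"
    and ShA_Add: "f \<in> Hom C X Y \<Longrightarrow> g \<in> Hom C X Y \<Longrightarrow>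
      ShA C n (Add C f g) = Add C (ShA C n f) (ShA C n g)"
    and ShO_0: "X \<in> Obj C \<Longrightarrow> ShO C 0 X = X"
    and ShA_0: "f \<in> Arr C \<Longrightarrow> ShA C 0 f = f"
    and ShO_ShO: "X \<in> Obj C \<Longrightarrow> ShO C m (ShO C n X) = ShO C (m + n) X"
    and ShA_ShA: "f \<in> Arr C \<Longrightarrow> ShA C m (ShA C n f) = ShA C (m + n) f"
    and Dist_triangle: "t \<in> Dist C \<Longrightarrow> is_triangle C t"
    and TR1_iso: "t \<in> Dist C \<Longrightarrow> is_triangle C t' \<Longrightarrow> triangle_hom C t t' (a, b, c) \<Longrightarrow>
      is_iso C a \<Longrightarrow> is_iso C b \<Longrightarrow> is_iso C c \<Longrightarrow> t' \<in> Dist C"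
    and TR1_Id: "X \<in> Obj C \<Longrightarrow> is_zero_object C Z \<Longrightarrow>
      (Id C X, Zero C X Z, Zero C Z (ShO C 1 X)) \<in> Dist C"
    and TR1_cone: "f \<in> Arr C \<Longrightarrow> \<exists>g h. (f, g, h) \<in> Dist C"
    and TR2: "is_triangle C (f, g, h) \<Longrightarrow>
      (f, g, h) \<in> Dist C \<longleftrightarrow> (g, h, Neg C (ShA C 1 f)) \<in> Dist C"
    and TR3: "(f, g, h) \<in> Dist C \<Longrightarrow> (f', g', h') \<in> Dist C \<Longrightarrow>
      a \<in> Hom C (Dom C f) (Dom C f') \<Longrightarrow> b \<in> Hom C (Dom C g) (Dom C g') \<Longrightarrow>
      b \<cdot> f = f' \<cdot> a \<Longrightarrow> \<exists>c. triangle_hom C (f, g, h) (f', g', h') (a, b, c)"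
    and TR4: "f \<in> Hom C X Y \<Longrightarrow> g \<in> Hom C Y Z \<Longrightarrow>
      (f, p\<^sub>1, d\<^sub>1) \<in> Dist C \<Longrightarrow> (g \<cdot> f, p\<^sub>2, d\<^sub>2) \<in> Dist C \<Longrightarrow> (g, p\<^sub>3, d\<^sub>3) \<in> Dist C \<Longrightarrow>
      \<exists>a b. (a, b, ShA C 1 p\<^sub>1 \<cdot> d\<^sub>3) \<in> Dist C \<and>
        triangle_hom C (f, p\<^sub>1, d\<^sub>1) (g \<cdot> f, p\<^sub>2, d\<^sub>2) (Id C X, g, a) \<and>
        triangle_hom C (g \<cdot> f, p\<^sub>2, d\<^sub>2) (g, p\<^sub>3, d\<^sub>3) (f, Id C Z, b)"


section \<open>t-structures\<close>

text \<open>Full subcategories are represented by their sets of objects.\<close>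

definition full_additive_subcategory ::
  "('o, 'm, 'x) preadditive_scheme \<Rightarrow> 'o set \<Rightarrow> bool" where
  "full_additive_subcategory C A \<longleftrightarrow> A \<subseteq> Obj C \<and>
    (\<forall>X \<in> A. \<forall>Y \<in> Obj C. isomorphic C X Y \<longrightarrow> Y \<in> A) \<and>
    (\<forall>Z. is_zero_object C Z \<longrightarrow> Z \<in> A) \<and>
    (\<forall>X \<in> A. \<forall>Y \<in> A. \<forall>S \<in> Obj C. \<forall>i j p q. is_biproduct C X Y S i j p q \<longrightarrow> S \<in> A)"

record 'o t_struct =
  aisle :: "'o set"
  coaisle :: "'o set"

definition le :: "('o, 'm, 'x) triangulated_scheme \<Rightarrow> 'o t_struct \<Rightarrow> int \<Rightarrow> 'o set" where
  "le C D i = ShO C (- i) ` aisle D"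

definition ge :: "('o, 'm, 'x) triangulated_scheme \<Rightarrow> 'o t_struct \<Rightarrow> int \<Rightarrow> 'o set" where
  "ge C D i = ShO C (- i) ` coaisle D"

definition heart :: "'o t_struct \<Rightarrow> 'o set" where
  "heart D = aisle D \<inter> coaisle D"

definition nondegenerate :: "('o, 'm, 'x) triangulated_scheme \<Rightarrow> 'o t_struct \<Rightarrow> bool" where
  "nondegenerate C D \<longleftrightarrow>
    (\<Inter>i. le C D i) = {Z. is_zero_object C Z} \<and> (\<Inter>i. ge C D i) = {Z. is_zero_object C Z}"

text \<open>Non-degeneracy is built in: it is a standing assumption on all t-structures.\<close>

definition t_structure :: "('o, 'm, 'x) triangulated_scheme \<Rightarrow> 'o t_struct \<Rightarrow> bool" where
  "t_structure C D \<longleftrightarrow>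
    full_additive_subcategory C (aisle D) \<and> full_additive_subcategory C (coaisle D) \<and>
    le C D 0 \<subseteq> le C D 1 \<and> ge C D 1 \<subseteq> ge C D 0 \<and>
    (\<forall>X \<in> le C D 0. \<forall>Y \<in> ge C D 1. Hom C X Y = {Zero C X Y}) \<and>
    (\<forall>X \<in> Obj C. \<exists>A \<in> le C D 0. \<exists>B \<in> ge C D 1. \<exists>f g h.
      f \<in> Hom C A X \<and> g \<in> Hom C X B \<and> h \<in> Hom C B (ShO C 1 A) \<and> (f, g, h) \<in> Dist C) \<and>
    nondegenerate C D"

text \<open>A right adjoint to the inclusion of the full subcategory \<open>A\<close>, given by a counit \<open>e\<close>;
  the functor is viewed as an endofunctor with values in \<open>A\<close>.\<close>

definition right_adjoint_to_inclusion ::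
  "('o, 'm, 'x) category_scheme \<Rightarrow> 'o set \<Rightarrow> ('o \<Rightarrow> 'o) \<Rightarrow> ('m \<Rightarrow> 'm) \<Rightarrow> bool" where
  "right_adjoint_to_inclusion C A Fo Fa \<longleftrightarrow>
    endofunctor C Fo Fa \<and> Fo ` Obj C \<subseteq> A \<and>
    (\<exists>e. (\<forall>X \<in> Obj C. e X \<in> Hom C (Fo X) X) \<and>
      (\<forall>X \<in> Obj C. \<forall>Y \<in> Obj C. \<forall>f \<in> Hom C X Y. e Y \<cdot>\<^bsub>C\<^esub> Fa f = f \<cdot>\<^bsub>C\<^esub> e X) \<and>
      (\<forall>X \<in> Obj C. \<forall>B \<in> A. bij_betw (\<lambda>g. e X \<cdot>\<^bsub>C\<^esub> g) (Hom C B (Fo X)) (Hom C B X)))"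

definition truncation_functor ::
  "('o, 'm, 'x) triangulated_scheme \<Rightarrow> 'o t_struct \<Rightarrow> int \<Rightarrow> ('o \<Rightarrow> 'o) \<Rightarrow> ('m \<Rightarrow> 'm) \<Rightarrow> bool" where
  "truncation_functor C D i Fo Fa \<longleftrightarrow> right_adjoint_to_inclusion C (le C D i) Fo Fa"


section \<open>Pairs of t-structures\<close>

definition of_type ::
  "('o, 'm, 'x) triangulated_scheme \<Rightarrow> 'o t_struct \<Rightarrow> 'o t_struct \<Rightarrow> nat \<Rightarrow> int \<Rightarrow> bool" where
  "of_type C D T n k \<longleftrightarrow>
    le C T k \<subseteq> le C D 0 \<and> (\<forall>k'. le C T k' \<subseteq> le C D 0 \<longrightarrow> k' \<le> k) \<and>
    le C D (- int n) \<subseteq> le C T k \<and> (\<forall>m. le C D (- int m) \<subseteq> le C T k \<longrightarrow> n \<le> m)"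

definition left_filterable ::
  "('o, 'm, 'x) triangulated_scheme \<Rightarrow> 'o t_struct \<Rightarrow> 'o t_struct \<Rightarrow> bool" where
  "left_filterable C D T \<longleftrightarrow>
    (\<forall>i. \<exists>E. t_structure C E \<and> aisle E = le C D i \<inter> le C T 0)"

text \<open>The description operator is justified because a t-structure is determined by its aisle.\<close>

definition left_basic ::
  "('o, 'm, 'x) triangulated_scheme \<Rightarrow> 'o t_struct \<Rightarrow> 'o t_struct \<Rightarrow> nat \<Rightarrow> nat \<Rightarrow> 'o t_struct" where
  "left_basic C D T n i =
    (THE E. t_structure C E \<and> aisle E = le C D 0 \<inter> le C T (int n - int i))"

definition left_basic_torsion_class ::
  "('o, 'm, 'x) triangulated_scheme \<Rightarrow> 'o t_struct \<Rightarrow> 'o t_struct \<Rightarrow> nat \<Rightarrow> nat \<Rightarrow> 'o set" where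
  "left_basic_torsion_class C D T n i =
    le C (left_basic C D T n (i + 1)) 0 \<inter> heart (left_basic C D T n i)"

text \<open>Truncation functors are unique up to isomorphism and \<open>T\<^sup>\<le>\<^sup>0\<close> is closed under isomorphisms,
  so the condition does not depend on the choice of the truncation functor.\<close>

definition left_compatible ::
  "('o, 'm, 'x) triangulated_scheme \<Rightarrow> 'o t_struct \<Rightarrow> 'o t_struct \<Rightarrow> bool" where
  "left_compatible C D T \<longleftrightarrow>
    (\<forall>i Fo Fa. truncation_functor C D i Fo Fa \<longrightarrow> Fo ` le C T 0 \<subseteq> le C T 0)"

end

theory Submission
  imports Defs
begin

text \<open>Write \<open>m = n - i - 1\<close>. Right orthogonality describes the coaisle of each t-structure, so
  the left basic torsion class with index \<open>i\<close> consists of the objects \<open>Y\<close> of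
  \<open>D\<^sup>\<le>\<^sup>0 \<inter> T\<^sup>\<le>\<^sup>m\<close> that receive no nonzero arrow from \<open>D\<^sup>\<le>\<^sup>-\<^sup>1 \<inter> T\<^sup>\<le>\<^sup>m\<close>
  (\<open>mem_torsion_class_iff\<close>), and \<open>Y\<close> lies in the heart of \<open>D\<close> exactly when it receives no nonzero
  arrow from the whole of \<open>D\<^sup>\<le>\<^sup>-\<^sup>1\<close>. The two conditions differ by the question whether truncation
  with respect to \<open>D\<close> stays inside \<open>T\<^sup>\<le>\<^sup>m\<close>, which is left compatibility up to a shift.

  If \<open>T\<close> is left compatible, the truncation of such a \<open>Y\<close> to \<open>D\<^sup>\<le>\<^sup>-\<^sup>1\<close> lies in
  \<open>D\<^sup>\<le>\<^sup>-\<^sup>1 \<inter> T\<^sup>\<le>\<^sup>m\<close>, so its counit vanishes; every arrow from \<open>D\<^sup>\<le>\<^sup>-\<^sup>1\<close> to \<open>Y\<close> factors through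
  the counit and vanishes as well (\<open>torsion_class_subset_heart\<close>). For objects of the heart of \<open>D\<close>
  the orthogonality condition holds automatically for every \<open>i\<close>, and the remaining condition, to lie
  in \<open>T\<^sup>\<le>\<^sup>m\<close>, gives the chain of inclusions (\<open>torsion_class_decreasing\<close>).

  Conversely, truncate \<open>X \<in> D\<^sup>\<le>\<^sup>0 \<inter> T\<^sup>\<le>\<^sup>m\<close> with respect to the \<open>i\<close>-th left basic t-structure instead
  of \<open>D\<close>, to get a triangle \<open>A \<rightarrow> X \<rightarrow> B\<close> with \<open>A \<in> D\<^sup>\<le>\<^sup>-\<^sup>1 \<inter> T\<^sup>\<le>\<^sup>m\<close>. Then \<open>B\<close> is in the torsion
  class, hence in \<open>D\<^sup>\<ge>\<^sup>0\<close>, so the same triangle is the truncation triangle for \<open>D\<close> and the truncation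
  \<open>A\<close> of \<open>X\<close> lies in \<open>T\<^sup>\<le>\<^sup>m\<close> (\<open>truncation_below_heart\<close>). Starting from \<open>T\<^sup>\<le>\<^sup>0\<close> and lowering the
  truncation degree by one at a time, with \<open>m = 0, 1, \<dots>, n - 1\<close> in turn, shows that all truncations
  stay in \<open>T\<^sup>\<le>\<^sup>0\<close>; below degree \<open>-n\<close> there is nothing to show as \<open>D\<^sup>\<le>\<^sup>-\<^sup>n \<subseteq> T\<^sup>\<le>\<^sup>0\<close>.

  A truncation functor enters only through its values on objects, which are the coreflections
  of objects into \<open>D\<^sup>\<le>\<^sup>i\<close>. These compose, shift and are unique up to isomorphism, and the argument
  is carried out with them.\<close>


section \<open>Additive categories\<close>

context additive_category
begin

lemma Hom_Obj:
  assumes "f \<in> Hom C X Y"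
  shows "X \<in> Obj C" and "Y \<in> Obj C"
  using assms Dom_Obj Cod_Obj by (auto simp: Hom_def)

lemma Zero_Hom: "X \<in> Obj C \<Longrightarrow> Y \<in> Obj C \<Longrightarrow> Zero C X Y \<in> Hom C X Y"
  using comm_group.axioms(2)[OF Hom_comm_group, THEN group.is_monoid, THEN monoid.one_closed]
  by (auto simp: Hom_group_def)

lemma Add_Hom: "f \<in> Hom C X Y \<Longrightarrow> g \<in> Hom C X Y \<Longrightarrow> Add C f g \<in> Hom C X Y"
  using comm_group.axioms(2)[OF Hom_comm_group, THEN group.is_monoid, THEN monoid.m_closed, of X Y f g]
    Hom_Obj[of f X Y]
  by (auto simp: Hom_group_def)

lemma Zero_Add: "f \<in> Hom C X Y \<Longrightarrow> Add C (Zero C X Y) f = f"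
  using comm_group.axioms(2)[OF Hom_comm_group, THEN group.is_monoid, THEN monoid.l_one, of X Y f]
    Hom_Obj[of f X Y]
  by (auto simp: Hom_group_def)

lemma Add_eq_right:
  assumes "f \<in> Hom C X Y" "g \<in> Hom C X Y" "Add C f g = g"
  shows "f = Zero C X Y"
proof -
  interpret G: comm_group "Hom_group C X Y" using Hom_comm_group Hom_Obj[OF assms(1)] by blast
  show ?thesis using G.l_cancel_one[of g f] G.r_cancel_one[of g f] assms
    by (auto simp: Hom_group_def)
qed

lemma Neg_Hom: "f \<in> Hom C X Y \<Longrightarrow> Neg C f \<in> Hom C X Y"
  and Neg_Add: "f \<in> Hom C X Y \<Longrightarrow> Add C (Neg C f) f = Zero C X Y"
proof -
  assume f: "f \<in> Hom C X Y"
  interpret G: comm_group "Hom_group C X Y" using Hom_comm_group Hom_Obj[OF f] by blast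
  have d: "Dom C f = X" "Cod C f = Y" using f by (auto simp: Hom_def)
  show "Neg C f \<in> Hom C X Y" using G.inv_closed[of f] f d by (auto simp: Hom_group_def Neg_def)
  show "Add C (Neg C f) f = Zero C X Y" using G.l_inv[of f] f d by (auto simp: Hom_group_def Neg_def)
qed

lemma Neg_unique:
  assumes "f \<in> Hom C X Y" "g \<in> Hom C X Y" "Add C g f = Zero C X Y"
  shows "g = Neg C f"
proof -
  interpret G: comm_group "Hom_group C X Y" using Hom_comm_group Hom_Obj[OF assms(1)] by blast
  have d: "Dom C f = X" "Cod C f = Y" using assms by (auto simp: Hom_def)
  show ?thesis using G.inv_equality[of g f] assms d by (auto simp: Hom_group_def Neg_def)
qed

lemma Neg_Neg: "f \<in> Hom C X Y \<Longrightarrow> Neg C (Neg C f) = f"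
proof -
  assume f: "f \<in> Hom C X Y"
  interpret G: comm_group "Hom_group C X Y" using Hom_comm_group Hom_Obj[OF f] by blast
  have "Add C f (Neg C f) = Zero C X Y"
    using G.m_comm[of f "Neg C f"] f Neg_Hom[OF f] Neg_Add[OF f] by (simp add: Hom_group_def)
  then show "Neg C (Neg C f) = f" using Neg_unique[OF Neg_Hom[OF f] f] by simp
qed

lemma Neg_Zero:
  assumes "X \<in> Obj C" "Y \<in> Obj C"
  shows "Neg C (Zero C X Y) = Zero C X Y"
  using Neg_unique[of "Zero C X Y" X Y "Zero C X Y"] Zero_Hom[OF assms] Zero_Add by simp

lemma Comp_Zero:
  assumes f: "f \<in> Hom C X Y" and W: "W \<in> Obj C"
  shows "f \<cdot> Zero C W X = Zero C W Y"
proof -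
  have z: "Zero C W X \<in> Hom C W X" using Zero_Hom Hom_Obj(1)[OF f] W by simp
  have "Add C (f \<cdot> Zero C W X) (f \<cdot> Zero C W X) = f \<cdot> Zero C W X"
    using Add_Comp[OF z z f] Zero_Add[OF z] by simp
  then show ?thesis using Add_eq_right Comp_Hom[OF z f] by simp
qed

lemma Zero_Comp:
  assumes f: "f \<in> Hom C X Y" and W: "W \<in> Obj C"
  shows "Zero C Y W \<cdot> f = Zero C X W"
proof -
  have z: "Zero C Y W \<in> Hom C Y W" using Zero_Hom Hom_Obj(2)[OF f] W by simp
  have "Add C (Zero C Y W \<cdot> f) (Zero C Y W \<cdot> f) = Zero C Y W \<cdot> f"
    using Comp_Add[OF f z z] Zero_Add[OF z] by simp
  then show ?thesis using Add_eq_right Comp_Hom[OF f z] by simp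
qed

lemma Comp_Neg:
  assumes f: "f \<in> Hom C X Y" and g: "g \<in> Hom C Y Z"
  shows "g \<cdot> Neg C f = Neg C (g \<cdot> f)"
proof (rule Neg_unique[OF Comp_Hom[OF f g] Comp_Hom[OF Neg_Hom[OF f] g]])
  show "Add C (g \<cdot> Neg C f) (g \<cdot> f) = Zero C X Z"
    using Add_Comp[OF Neg_Hom[OF f] f g] Neg_Add[OF f] Comp_Zero[OF g Hom_Obj(1)[OF f]] by simp
qed

lemma Neg_Comp:
  assumes f: "f \<in> Hom C X Y" and g: "g \<in> Hom C Y Z"
  shows "Neg C g \<cdot> f = Neg C (g \<cdot> f)"
proof (rule Neg_unique[OF Comp_Hom[OF f g] Comp_Hom[OF f Neg_Hom[OF g]]])
  show "Add C (Neg C g \<cdot> f) (g \<cdot> f) = Zero C X Z"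
    using Comp_Add[OF f Neg_Hom[OF g] g] Neg_Add[OF g] Zero_Comp[OF f Hom_Obj(2)[OF g]] by simp
qed

lemma ex_difference:
  assumes "x \<in> Hom C X Y" "y \<in> Hom C X Y"
  shows "\<exists>d \<in> Hom C X Y. x = Add C d y"
proof -
  interpret G: comm_group "Hom_group C X Y" using Hom_comm_group Hom_Obj[OF assms(1)] by blast
  have y: "Neg C y \<in> Hom C X Y" using Neg_Hom assms by blast
  have "Add C (Add C x (Neg C y)) y = Add C x (Add C (Neg C y) y)"
    using G.m_assoc[of x "Neg C y" y] assms y by (simp add: Hom_group_def)
  also have "\<dots> = x" using G.r_one[of x] Neg_Add[OF assms(2)] assms by (simp add: Hom_group_def)
  finally show ?thesis using Add_Hom[OF assms(1) y] by metis
qed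

text \<open>The cancellation property of an arrow follows from its special case for the zero arrow,
  which is what the exactness of triangles provides.\<close>

lemma precomp_cancel:
  assumes "g \<in> Hom C X Y" "x \<in> Hom C Y Z" "y \<in> Hom C Y Z" "x \<cdot> g = y \<cdot> g"
    and "\<And>d. d \<in> Hom C Y Z \<Longrightarrow> d \<cdot> g = Zero C X Z \<Longrightarrow> d = Zero C Y Z"
  shows "x = y"
proof -
  obtain d where d: "d \<in> Hom C Y Z" "x = Add C d y" using ex_difference assms by blast
  have "Add C (d \<cdot> g) (y \<cdot> g) = y \<cdot> g" using Comp_Add d assms by metis
  then have "d \<cdot> g = Zero C X Z" using Add_eq_right Comp_Hom assms d by metis
  then show ?thesis using assms d Zero_Add by metis
qed

lemma postcomp_cancel:
  assumes "g \<in> Hom C X Y" "x \<in> Hom C W X" "y \<in> Hom C W X" "g \<cdot> x = g \<cdot> y"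
    and "\<And>d. d \<in> Hom C W X \<Longrightarrow> g \<cdot> d = Zero C W Y \<Longrightarrow> d = Zero C W X"
  shows "x = y"
proof -
  obtain d where d: "d \<in> Hom C W X" "x = Add C d y" using ex_difference assms by blast
  have "Add C (g \<cdot> d) (g \<cdot> y) = g \<cdot> y" using Add_Comp d assms by metis
  then have "g \<cdot> d = Zero C W Y" using Add_eq_right Comp_Hom assms d by metis
  then show ?thesis using assms d Zero_Add by metis
qed

lemma zero_object_Obj: "is_zero_object C Z \<Longrightarrow> Z \<in> Obj C"
  unfolding is_zero_object_def by simp

lemma Hom_zero_object:
  assumes "is_zero_object C Z" "X \<in> Obj C"
  shows "f \<in> Hom C X Z \<Longrightarrow> f = Zero C X Z" "f \<in> Hom C Z X \<Longrightarrow> f = Zero C Z X"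
  using assms Zero_Hom unfolding is_zero_object_def by blast+

lemma isomorphicI:
  assumes "f \<in> Hom C X Y" "g \<in> Hom C Y X" "g \<cdot> f = Id C X" "f \<cdot> g = Id C Y"
  shows "isomorphic C X Y"
  using assms unfolding isomorphic_def is_iso_def by (auto simp: Hom_def intro!: bexI[of _ f] bexI[of _ g])

lemma isomorphicE:
  assumes "isomorphic C X Y"
  obtains f g where "f \<in> Hom C X Y" "g \<in> Hom C Y X" "g \<cdot> f = Id C X" "f \<cdot> g = Id C Y"
  using assms unfolding isomorphic_def is_iso_def by (auto simp: Hom_def)

end

section \<open>Triangulated categories\<close>

context triangulated_category
begin

lemma ShO_Obj: "X \<in> Obj C \<Longrightarrow> ShO C k X \<in> Obj C"
  using Sh_endofunctor[of k] unfolding endofunctor_def by blast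

lemma ShA_Id: "X \<in> Obj C \<Longrightarrow> ShA C k (Id C X) = Id C (ShO C k X)"
  using Sh_endofunctor[of k] unfolding endofunctor_def by blast

lemma ShA_Hom: "f \<in> Hom C X Y \<Longrightarrow> ShA C k f \<in> Hom C (ShO C k X) (ShO C k Y)"
  using Sh_endofunctor[of k] Hom_Obj unfolding endofunctor_def by blast

lemma ShA_Comp: "f \<in> Hom C X Y \<Longrightarrow> g \<in> Hom C Y Z \<Longrightarrow> ShA C k (g \<cdot> f) = ShA C k g \<cdot> ShA C k f"
  using Sh_endofunctor[of k] Hom_Obj unfolding endofunctor_def by metis

lemma ShO_cancel: "X \<in> Obj C \<Longrightarrow> ShO C k (ShO C (- k) X) = X"
  "X \<in> Obj C \<Longrightarrow> ShO C (- k) (ShO C k X) = X"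
  by (simp_all add: ShO_ShO ShO_0)

lemma ShA_cancel: "f \<in> Hom C X Y \<Longrightarrow> ShA C k (ShA C (- k) f) = f"
  "f \<in> Hom C X Y \<Longrightarrow> ShA C (- k) (ShA C k f) = f"
  by (simp_all add: ShA_ShA ShA_0 Hom_def)

lemma ShA_Zero:
  assumes "X \<in> Obj C" "Y \<in> Obj C"
  shows "ShA C k (Zero C X Y) = Zero C (ShO C k X) (ShO C k Y)"
proof -
  have z: "Zero C X Y \<in> Hom C X Y" using Zero_Hom assms by simp
  show ?thesis using Add_eq_right[OF ShA_Hom[OF z] ShA_Hom[OF z]] ShA_Add[OF z z] Zero_Add[OF z]
    by metis
qed

lemma ShA_Neg:
  assumes f: "f \<in> Hom C X Y"
  shows "ShA C k (Neg C f) = Neg C (ShA C k f)"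
  using Neg_unique[OF ShA_Hom[OF f] ShA_Hom[OF Neg_Hom[OF f]]] ShA_Add[OF Neg_Hom[OF f] f]
    Neg_Add[OF f] ShA_Zero[OF Hom_Obj[OF f]] by simp

lemma ShA_bij:
  assumes "X \<in> Obj C" "Y \<in> Obj C"
  shows "bij_betw (ShA C k) (Hom C X Y) (Hom C (ShO C k X) (ShO C k Y))"
proof (rule bij_betw_byWitness[of _ "ShA C (- k)"])
  show "ShA C (- k) ` Hom C (ShO C k X) (ShO C k Y) \<subseteq> Hom C X Y"
    using ShA_Hom[of _ "ShO C k X" "ShO C k Y" "- k"] assms by (auto simp: ShO_cancel)
qed (use ShA_cancel ShA_Hom in auto)

lemma ShA_eq_Zero:
  assumes "f \<in> Hom C X Y" "ShA C k f = Zero C (ShO C k X) (ShO C k Y)"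
  shows "f = Zero C X Y"
  using assms Hom_Obj[OF assms(1)] by (metis ShA_Zero ShA_cancel(2) Zero_Hom)

lemma Hom_Sh_trivial:
  assumes "X \<in> Obj C" "Y \<in> Obj C" "Hom C X Y = {Zero C X Y}"
  shows "Hom C (ShO C k X) (ShO C k Y) = {Zero C (ShO C k X) (ShO C k Y)}"
  using bij_betw_imp_surj_on[OF ShA_bij[OF assms(1,2), of k]] assms by (simp add: ShA_Zero)

lemma isomorphic_Sh:
  assumes "isomorphic C X Y"
  shows "isomorphic C (ShO C k X) (ShO C k Y)"
proof -
  obtain f g where fg: "f \<in> Hom C X Y" "g \<in> Hom C Y X" "g \<cdot> f = Id C X" "f \<cdot> g = Id C Y"
    using isomorphicE assms by blast
  then have "ShA C k g \<cdot> ShA C k f = Id C (ShO C k X)" "ShA C k f \<cdot> ShA C k g = Id C (ShO C k Y)"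
    using ShA_Comp ShA_Id Hom_Obj by metis+
  then show ?thesis using fg ShA_Hom isomorphicI by blast
qed

lemma is_zero_object_Sh:
  assumes "is_zero_object C Z" shows "is_zero_object C (ShO C k Z)"
proof -
  have Z: "Z \<in> Obj C" using assms zero_object_Obj by blast
  have "Hom C X Z = {Zero C X Z} \<and> Hom C Z X = {Zero C Z X}" if "X \<in> Obj C" for X
    using Hom_zero_object[OF assms that] Zero_Hom Z that by blast
  then have "Hom C X (ShO C k Z) = {Zero C X (ShO C k Z)} \<and> Hom C (ShO C k Z) X = {Zero C (ShO C k Z) X}"
    if "X \<in> Obj C" for X
    using Hom_Sh_trivial[of "ShO C (-k) X" Z k] Hom_Sh_trivial[of Z "ShO C (-k) X" k] Z that
    by (simp add: ShO_Obj ShO_cancel)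
  then show ?thesis using ShO_Obj[OF Z] unfolding is_zero_object_def by (metis singleton_iff)
qed

lemma is_biproduct_Sh:
  assumes "is_biproduct C X Y S i j p q"
  shows "is_biproduct C (ShO C k X) (ShO C k Y) (ShO C k S) (ShA C k i) (ShA C k j) (ShA C k p) (ShA C k q)"
proof -
  note a = assms[unfolded is_biproduct_def]
  have o: "X \<in> Obj C" "Y \<in> Obj C" "S \<in> Obj C" using a Hom_Obj by blast+
  have "Add C (ShA C k i \<cdot> ShA C k p) (ShA C k j \<cdot> ShA C k q) = Id C (ShO C k S)"
  proof -
    have h: "i \<in> Hom C X S" "p \<in> Hom C S X" "j \<in> Hom C Y S" "q \<in> Hom C S Y" using a by blast+
    show ?thesis
      using a ShA_Add[OF Comp_Hom[OF h(2,1)] Comp_Hom[OF h(4,3)], of k]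
        ShA_Comp[OF h(2,1), of k] ShA_Comp[OF h(4,3), of k] ShA_Id[OF o(3)] by simp
  qed
  moreover have "ShA C k p \<cdot> ShA C k i = Id C (ShO C k X)" "ShA C k q \<cdot> ShA C k j = Id C (ShO C k Y)"
    "ShA C k q \<cdot> ShA C k i = Zero C (ShO C k X) (ShO C k Y)"
    "ShA C k p \<cdot> ShA C k j = Zero C (ShO C k Y) (ShO C k X)"
    using a o ShA_Comp ShA_Zero ShA_Id by metis+
  ultimately show ?thesis using a ShA_Hom unfolding is_biproduct_def by blast
qed

lemma is_triangleI:
  "f \<in> Hom C X Y \<Longrightarrow> g \<in> Hom C Y Z \<Longrightarrow> h \<in> Hom C Z (ShO C 1 X) \<Longrightarrow> is_triangle C (f, g, h)"
  by (auto simp: is_triangle_def Hom_def)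

lemma rotate_triangle:
  assumes "f \<in> Hom C X Y" "g \<in> Hom C Y Z" "h \<in> Hom C Z (ShO C 1 X)" "(f, g, h) \<in> Dist C"
  shows "(g, h, Neg C (ShA C 1 f)) \<in> Dist C"
  using assms TR2 is_triangleI by blast

text \<open>The triangle \<open>0 \<rightarrow> U \<rightarrow> U \<rightarrow> 0\<close>; its first object has to be written as \<open>Z[-1]\<close> for the third
  object \<open>Z\<close>, so that rotation turns it literally into \<open>U \<rightarrow> U \<rightarrow> Z \<rightarrow> U[1]\<close>.\<close>

lemma triangle_zero_Id:
  assumes "is_zero_object C Z" "U \<in> Obj C"
  shows "(Zero C (ShO C (- 1) Z) U, Id C U, Zero C U Z) \<in> Dist C"
proof -
  have Z: "Z \<in> Obj C" using assms zero_object_Obj by blast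
  let ?f = "Zero C (ShO C (- 1) Z) U"
  have f: "?f \<in> Hom C (ShO C (- 1) Z) U" using Z assms ShO_Obj Zero_Hom by blast
  have "Neg C (ShA C 1 ?f) = Zero C Z (ShO C 1 U)"
    using Z assms by (simp add: ShA_Zero ShO_Obj ShO_cancel Neg_Zero)
  moreover have "is_triangle C (?f, Id C U, Zero C U Z)"
    by (rule is_triangleI[OF f Id_Hom]) (use Z assms Zero_Hom ShO_cancel in auto)
  ultimately show ?thesis using TR2 TR1_Id[OF assms(2,1)] by metis
qed

text \<open>Exactness of \<open>Hom(-, U)\<close> on a triangle: the square from \<open>X \<rightarrow> Y\<close> to \<open>0 \<rightarrow> U\<close> formed by \<open>u\<close>
  extends to a morphism into the triangle \<open>0 \<rightarrow> U \<rightarrow> U \<rightarrow> 0\<close>.\<close>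

lemma factor_through_cone:
  assumes t: "f \<in> Hom C X Y" "g \<in> Hom C Y Z" "(f, g, h) \<in> Dist C"
    and u: "u \<in> Hom C Y U" "u \<cdot> f = Zero C X U"
  shows "\<exists>s \<in> Hom C Z U. u = s \<cdot> g"
proof -
  obtain O' where O: "is_zero_object C O'" using ex_zero_object by blast
  have o: "O' \<in> Obj C" "X \<in> Obj C" "U \<in> Obj C" using O t u Hom_Obj zero_object_Obj by blast+
  let ?O = "ShO C (- 1) O'"
  have oo: "?O \<in> Obj C" using o ShO_Obj by blast
  have d: "Dom C f = X" "Dom C g = Y" "Dom C h = Z" "Dom C (Id C U) = U" "Dom C (Zero C ?O U) = ?O"
    "Dom C (Zero C U O') = U"
    using t Dist_triangle[OF t(3)] Id_Hom[OF o(3)] Zero_Hom[OF oo o(3)] Zero_Hom[OF o(3,1)]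
    by (auto simp: Hom_def is_triangle_def)
  have "u \<cdot> f = Zero C ?O U \<cdot> Zero C X ?O" using u Zero_Comp[OF Zero_Hom] oo o by simp
  then obtain c where "triangle_hom C (f, g, h) (Zero C ?O U, Id C U, Zero C U O') (Zero C X ?O, u, c)"
    using TR3[OF t(3) triangle_zero_Id[OF O o(3)], of "Zero C X ?O" u] d u Zero_Hom oo o by auto
  then have "c \<in> Hom C Z U" "c \<cdot> g = Id C U \<cdot> u" using d unfolding triangle_hom_def by auto
  then show ?thesis using Id_Comp u by auto
qed

text \<open>Exactness of \<open>Hom(W, -)\<close> on a triangle. A morphism of triangles is completed at its third
  arrow, so the factorization is found in the rotated triangles, between \<open>W[1]\<close> and \<open>X[1]\<close>, and
  is shifted back; the signs of the two rotations cancel.\<close>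

lemma factor_through_fibre:
  assumes t: "f \<in> Hom C X Y" "g \<in> Hom C Y Z" "h \<in> Hom C Z (ShO C 1 X)" "(f, g, h) \<in> Dist C"
    and u: "u \<in> Hom C W Y" "g \<cdot> u = Zero C W Z"
  shows "\<exists>s \<in> Hom C W X. u = f \<cdot> s"
proof -
  obtain O' where O: "is_zero_object C O'" using ex_zero_object by blast
  have o: "O' \<in> Obj C" "W \<in> Obj C" "X \<in> Obj C" "Y \<in> Obj C" "Z \<in> Obj C"
    using O t u Hom_Obj zero_object_Obj by blast+
  let ?W = "ShO C 1 W"
  have oo: "?W \<in> Obj C" using o ShO_Obj by blast
  have i: "Neg C (ShA C 1 (Id C W)) = Neg C (Id C ?W)" using ShA_Id o by simp
  have h: "Id C W \<in> Hom C W W" "Id C ?W \<in> Hom C ?W ?W" "Zero C W O' \<in> Hom C W O'"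
    "Zero C O' ?W \<in> Hom C O' ?W" "Neg C (Id C ?W) \<in> Hom C ?W ?W"
    "Neg C (ShA C 1 f) \<in> Hom C (ShO C 1 X) (ShO C 1 Y)"
    using o oo Id_Hom Zero_Hom Neg_Hom ShA_Hom t by blast+
  have s: "(Zero C W O', Zero C O' ?W, Neg C (Id C ?W)) \<in> Dist C"
    using rotate_triangle[OF h(1,3,4) TR1_Id[OF o(2) O]] i by simp
  have d: "Dom C g = Y" "Dom C h = Z" "Dom C (Neg C (ShA C 1 f)) = ShO C 1 X"
    "Dom C (Zero C W O') = W" "Dom C (Zero C O' ?W) = O'" "Dom C (Neg C (Id C ?W)) = ?W"
    using t h by (auto simp: Hom_def)
  have "Zero C O' Z \<cdot> Zero C W O' = g \<cdot> u" using u Zero_Comp[OF Zero_Hom] oo o by simp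
  then obtain c where "triangle_hom C (Zero C W O', Zero C O' ?W, Neg C (Id C ?W))
      (g, h, Neg C (ShA C 1 f)) (u, Zero C O' Z, c)"
    using TR3[OF s rotate_triangle[OF t], of u "Zero C O' Z"] d u Zero_Hom o by auto
  then have c: "c \<in> Hom C ?W (ShO C 1 X)" "ShA C 1 u \<cdot> Neg C (Id C ?W) = Neg C (ShA C 1 f) \<cdot> c"
    using d unfolding triangle_hom_def by auto
  have u1: "ShA C 1 u \<in> Hom C ?W (ShO C 1 Y)" and f1: "ShA C 1 f \<in> Hom C (ShO C 1 X) (ShO C 1 Y)"
    using u t ShA_Hom by blast+
  have "Neg C (ShA C 1 u) = Neg C (ShA C 1 f \<cdot> c)"
    using c(2) Comp_Neg[OF h(2) u1] Neg_Comp[OF c(1) f1] Comp_Id[OF u1] by simp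
  then have e: "ShA C 1 u = ShA C 1 f \<cdot> c" using Neg_Neg u1 Comp_Hom[OF c(1) f1] by metis
  have c': "ShA C (- 1) c \<in> Hom C W X" using ShA_Hom[OF c(1), of "- 1"] o by (simp add: ShO_cancel)
  have "ShA C 1 u = ShA C 1 (f \<cdot> ShA C (- 1) c)"
    using ShA_Comp[OF c' t(1), of 1] ShA_cancel(1)[OF c(1), of 1] e by simp
  then have "u = f \<cdot> ShA C (- 1) c" using ShA_cancel(2) u Comp_Hom[OF c' t(1)] by metis
  then show ?thesis using c' by blast
qed

text \<open>Three rotations shift a triangle by one and change all signs. As only the objects matter
  later on, the signs are hidden in the existential quantifiers.\<close>

lemma shift_triangle:
  assumes t: "f \<in> Hom C X Y" "g \<in> Hom C Y Z" "h \<in> Hom C Z (ShO C 1 X)" "(f, g, h) \<in> Dist C"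
  shows "\<exists>f' \<in> Hom C (ShO C k X) (ShO C k Y). \<exists>g' \<in> Hom C (ShO C k Y) (ShO C k Z).
    \<exists>h' \<in> Hom C (ShO C k Z) (ShO C 1 (ShO C k X)). (f', g', h') \<in> Dist C"
proof -
  have o: "X \<in> Obj C" "Y \<in> Obj C" "Z \<in> Obj C" using t Hom_Obj by blast+
  have up: "(Neg C (ShA C 1 f), Neg C (ShA C 1 g), Neg C (ShA C 1 h)) \<in> Dist C"
    if t: "f \<in> Hom C X Y" "g \<in> Hom C Y Z" "h \<in> Hom C Z (ShO C 1 X)" "(f, g, h) \<in> Dist C"
    for f g h X Y Z
  proof -
    note h1 = t(1)[THEN ShA_Hom, THEN Neg_Hom, of 1] and h2 = t(2)[THEN ShA_Hom, THEN Neg_Hom, of 1]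
    show ?thesis
      by (rule rotate_triangle[OF t(3) h1 h2])
        (rule rotate_triangle[OF t(2,3) h1], rule rotate_triangle[OF t])
  qed
  have down: "(f, g, h) \<in> Dist C"
    if t: "f \<in> Hom C X Y" "g \<in> Hom C Y Z" "h \<in> Hom C Z (ShO C 1 X)"
      "(Neg C (ShA C 1 f), Neg C (ShA C 1 g), Neg C (ShA C 1 h)) \<in> Dist C"
    for f g h X Y Z
  proof -
    have n: "Neg C (ShA C 1 f) \<in> Hom C (ShO C 1 X) (ShO C 1 Y)"
      "Neg C (ShA C 1 g) \<in> Hom C (ShO C 1 Y) (ShO C 1 Z)"
      using t Neg_Hom ShA_Hom by blast+
    have "(h, Neg C (ShA C 1 f), Neg C (ShA C 1 g)) \<in> Dist C" using TR2 t is_triangleI n by blast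
    then show ?thesis using TR2 t is_triangleI n by blast
  qed
  show ?thesis
  proof (induction k rule: int_induct[where k = 0])
    case base
    then show ?case using t o by (auto simp: ShO_0)
  next
    case (step1 k)
    then obtain f g h where "f \<in> Hom C (ShO C k X) (ShO C k Y)" "g \<in> Hom C (ShO C k Y) (ShO C k Z)"
      "h \<in> Hom C (ShO C k Z) (ShO C 1 (ShO C k X))" "(f, g, h) \<in> Dist C" by blast
    from up[OF this] this have
      "(Neg C (ShA C 1 f), Neg C (ShA C 1 g), Neg C (ShA C 1 h)) \<in> Dist C"
      "Neg C (ShA C 1 f) \<in> Hom C (ShO C 1 (ShO C k X)) (ShO C 1 (ShO C k Y))"
      "Neg C (ShA C 1 g) \<in> Hom C (ShO C 1 (ShO C k Y)) (ShO C 1 (ShO C k Z))"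
      "Neg C (ShA C 1 h) \<in> Hom C (ShO C 1 (ShO C k Z)) (ShO C 1 (ShO C 1 (ShO C k X)))"
      by (auto intro: Neg_Hom ShA_Hom)
    then show ?case using o by (simp add: ShO_ShO add.commute) blast
  next
    case (step2 k)
    then obtain f g h where *: "f \<in> Hom C (ShO C k X) (ShO C k Y)" "g \<in> Hom C (ShO C k Y) (ShO C k Z)"
      "h \<in> Hom C (ShO C k Z) (ShO C 1 (ShO C k X))" "(f, g, h) \<in> Dist C" by blast
    let ?f = "Neg C (ShA C (- 1) f)" and ?g = "Neg C (ShA C (- 1) g)" and ?h = "Neg C (ShA C (- 1) h)"
    have m: "?f \<in> Hom C (ShO C (k - 1) X) (ShO C (k - 1) Y)" "?g \<in> Hom C (ShO C (k - 1) Y) (ShO C (k - 1) Z)"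
      "?h \<in> Hom C (ShO C (k - 1) Z) (ShO C 1 (ShO C (k - 1) X))"
      using *(1,2,3)[THEN ShA_Hom, THEN Neg_Hom, of "- 1"] o by (simp_all add: ShO_ShO)
    have "Neg C (ShA C 1 ?f) = f" "Neg C (ShA C 1 ?g) = g" "Neg C (ShA C 1 ?h) = h"
      using *(1-3)[THEN ShA_Hom, of "- 1", THEN ShA_Neg, of 1] *(1-3)[THEN Neg_Neg]
        *(1-3)[THEN ShA_cancel(1), of 1] *(1-3)[THEN ShA_Neg, of 1]
      by simp_all
    then show ?case using down[OF m] m *(4) by auto
  qed
qed

end


section \<open>Coreflections\<close>

text \<open>The value at a single object of a right adjoint to the inclusion of \<open>S\<close>, with its counit;
  it makes sense for an object without any choice of truncations for the other objects.\<close>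

definition coreflection ::
  "('o, 'm, 'x) category_scheme \<Rightarrow> 'o set \<Rightarrow> 'o \<Rightarrow> 'o \<Rightarrow> 'm \<Rightarrow> bool" where
  "coreflection C S X A e \<longleftrightarrow> A \<in> S \<and> e \<in> Hom C A X \<and>
    (\<forall>B \<in> S. bij_betw (\<lambda>g. e \<cdot>\<^bsub>C\<^esub> g) (Hom C B A) (Hom C B X))"

lemma coreflectionI:
  assumes "A \<in> S" "e \<in> Hom C A X"
    and "\<And>B u. B \<in> S \<Longrightarrow> u \<in> Hom C B X \<Longrightarrow> \<exists>!v. v \<in> Hom C B A \<and> e \<cdot>\<^bsub>C\<^esub> v = u"
    and "\<And>B v. v \<in> Hom C B A \<Longrightarrow> e \<cdot>\<^bsub>C\<^esub> v \<in> Hom C B X"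
  shows "coreflection C S X A e"
  using assms unfolding coreflection_def bij_betw_def inj_on_def image_def by fast

lemma coreflectionD:
  assumes "coreflection C S X A e"
  shows "A \<in> S" "e \<in> Hom C A X"
  using assms unfolding coreflection_def by auto

lemma coreflection_factor:
  assumes "coreflection C S X A e" "B \<in> S" "u \<in> Hom C B X"
  shows "\<exists>!v. v \<in> Hom C B A \<and> e \<cdot>\<^bsub>C\<^esub> v = u"
proof -
  have b: "bij_betw (\<lambda>g. e \<cdot>\<^bsub>C\<^esub> g) (Hom C B A) (Hom C B X)"
    using assms(1,2) unfolding coreflection_def by blast
  have "u \<in> (\<lambda>g. e \<cdot>\<^bsub>C\<^esub> g) ` Hom C B A" using bij_betw_imp_surj_on[OF b] assms(3) by simp
  then show ?thesis using inj_onD[OF bij_betw_imp_inj_on[OF b]] by auto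
qed

context additive_category
begin

lemma coreflection_Id:
  assumes "X \<in> S" "X \<in> Obj C"
  shows "coreflection C S X X (Id C X)"
proof (rule coreflectionI[OF assms(1) Id_Hom[OF assms(2)]])
  show "\<exists>!v. v \<in> Hom C B X \<and> Id C X \<cdot> v = u" if "u \<in> Hom C B X" for B u
    using that Id_Comp by metis
qed (simp add: Id_Comp)

lemma coreflection_trans:
  assumes e: "coreflection C S X A e" and d: "coreflection C S' A B d" and S: "S' \<subseteq> S"
  shows "coreflection C S' X B (e \<cdot> d)"
proof (rule coreflectionI)
  note eH = coreflectionD(2)[OF e] and dH = coreflectionD(2)[OF d]
  show "B \<in> S'" by (rule coreflectionD(1)[OF d])
  show ed: "e \<cdot> d \<in> Hom C B X" by (rule Comp_Hom[OF dH eH])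
  show "(e \<cdot> d) \<cdot> v \<in> Hom C W X" if "v \<in> Hom C W B" for W v by (rule Comp_Hom[OF that ed])
  fix W u assume W: "W \<in> S'" and u: "u \<in> Hom C W X"
  obtain v where v: "v \<in> Hom C W A" "e \<cdot> v = u" "\<And>v'. v' \<in> Hom C W A \<Longrightarrow> e \<cdot> v' = u \<Longrightarrow> v' = v"
    using coreflection_factor[OF e _ u] W S by blast
  obtain w where w: "w \<in> Hom C W B" "d \<cdot> w = v" "\<And>w'. w' \<in> Hom C W B \<Longrightarrow> d \<cdot> w' = v \<Longrightarrow> w' = w"
    using coreflection_factor[OF d W v(1)] by blast
  show "\<exists>!v. v \<in> Hom C W B \<and> (e \<cdot> d) \<cdot> v = u"
  proof (rule ex1I[of _ w])
    show "w \<in> Hom C W B \<and> (e \<cdot> d) \<cdot> w = u" using Comp_assoc[OF w(1) dH eH] v(2) w(1,2) by simp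
    fix w' assume w': "w' \<in> Hom C W B \<and> (e \<cdot> d) \<cdot> w' = u"
    then have "d \<cdot> w' = v"
      using Comp_assoc[OF _ dH eH, of w' W] by (intro v(3) Comp_Hom[OF _ dH]) auto
    then show "w' = w" using w(3) w' by blast
  qed
qed

lemma coreflection_unique:
  assumes e: "coreflection C S X A e" and d: "coreflection C S X B d"
  shows "isomorphic C A B"
proof -
  note A = coreflectionD[OF e] and B = coreflectionD[OF d]
  obtain a where a: "a \<in> Hom C A B" "d \<cdot> a = e" using coreflection_factor[OF d A] by blast
  obtain b where b: "b \<in> Hom C B A" "e \<cdot> b = d" using coreflection_factor[OF e B] by blast
  have o: "A \<in> Obj C" "B \<in> Obj C" using Hom_Obj a by blast+
  have "b \<cdot> a = Id C A"
    using coreflection_factor[OF e A] Comp_Hom[OF a(1) b(1)] Comp_assoc[OF a(1) b(1) A(2)]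
      a b Comp_Id[OF A(2)] Id_Hom[OF o(1)] by metis
  moreover have "a \<cdot> b = Id C B"
    using coreflection_factor[OF d B] Comp_Hom[OF b(1) a(1)] Comp_assoc[OF b(1) a(1) B(2)]
      a b Comp_Id[OF B(2)] Id_Hom[OF o(2)] by metis
  ultimately show ?thesis using isomorphicI a b by blast
qed

lemma right_adjoint_coreflection:
  assumes "right_adjoint_to_inclusion C S Fo Fa" "X \<in> Obj C"
  shows "\<exists>e. coreflection C S X (Fo X) e"
  using assms unfolding right_adjoint_to_inclusion_def coreflection_def by blast

text \<open>The prescribed value at \<open>X\<close> is arranged when coreflections are chosen, so that a property
  of all truncation functors applies to any given coreflection.\<close>

lemma ex_right_adjoint:
  assumes ex: "\<And>X. X \<in> Obj C \<Longrightarrow> \<exists>A e. coreflection C S X A e"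
    and X: "X \<in> Obj C" "coreflection C S X A e"
  shows "\<exists>Fo Fa. right_adjoint_to_inclusion C S Fo Fa \<and> Fo X = A"
proof -
  have "\<forall>Y. \<exists>B d. (Y \<in> Obj C \<longrightarrow> coreflection C S Y B d) \<and> (Y = X \<longrightarrow> B = A)"
    using ex X by metis
  then obtain Fo c where c: "\<And>Y. Y \<in> Obj C \<Longrightarrow> coreflection C S Y (Fo Y) (c Y)" and FX: "Fo X = A"
    by metis
  note cS = coreflectionD(1)[OF c] and cH = coreflectionD(2)[OF c]
  define Fa where "Fa f = (THE v. v \<in> Hom C (Fo (Dom C f)) (Fo (Cod C f)) \<and>
    c (Cod C f) \<cdot> v = f \<cdot> c (Dom C f))" for f
  have ex1: "\<exists>!v. v \<in> Hom C (Fo Y) (Fo Z) \<and> c Z \<cdot> v = f \<cdot> c Y" if f: "f \<in> Hom C Y Z" for f Y Z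
    using coreflection_factor[OF c cS Comp_Hom[OF cH f]] Hom_Obj[OF f] by blast
  have Fa: "Fa f \<in> Hom C (Fo Y) (Fo Z) \<and> c Z \<cdot> Fa f = f \<cdot> c Y" if f: "f \<in> Hom C Y Z" for f Y Z
  proof -
    have "Dom C f = Y" "Cod C f = Z" using f by (auto simp: Hom_def)
    then show ?thesis using theI'[OF ex1[OF f]] by (simp add: Fa_def)
  qed
  have Fa_eq: "Fa f = v" if "f \<in> Hom C Y Z" "v \<in> Hom C (Fo Y) (Fo Z)" "c Z \<cdot> v = f \<cdot> c Y" for f Y Z v
    using ex1[OF that(1)] Fa[OF that(1)] that by blast
  have o: "Fo Y \<in> Obj C" if "Y \<in> Obj C" for Y using Hom_Obj cH that by blast
  have Id: "Fa (Id C Y) = Id C (Fo Y)" if Y: "Y \<in> Obj C" for Y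
    by (rule Fa_eq[OF Id_Hom[OF Y] Id_Hom[OF o[OF Y]]])
      (simp add: Comp_Id[OF cH[OF Y]] Id_Comp[OF cH[OF Y]])
  have Comp: "Fa (g \<cdot> f) = Fa g \<cdot> Fa f" if f: "f \<in> Hom C Y Z" and g: "g \<in> Hom C Z W" for f g Y Z W
  proof (rule Fa_eq[OF Comp_Hom[OF f g]])
    note Ff = Fa[OF f, THEN conjunct1] and Fg = Fa[OF g, THEN conjunct1]
    have oY: "Y \<in> Obj C" "Z \<in> Obj C" "W \<in> Obj C" using Hom_Obj f g by blast+
    show "Fa g \<cdot> Fa f \<in> Hom C (Fo Y) (Fo W)" by (rule Comp_Hom[OF Ff Fg])
    have "c W \<cdot> (Fa g \<cdot> Fa f) = (c W \<cdot> Fa g) \<cdot> Fa f" using Comp_assoc[OF Ff Fg cH[OF oY(3)]] by simp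
    also have "\<dots> = g \<cdot> (c Z \<cdot> Fa f)" using Fa[OF g] Comp_assoc[OF Ff cH[OF oY(2)] g] by simp
    also have "\<dots> = (g \<cdot> f) \<cdot> c Y" using Fa[OF f] Comp_assoc[OF cH[OF oY(1)] f g] by simp
    finally show "c W \<cdot> (Fa g \<cdot> Fa f) = (g \<cdot> f) \<cdot> c Y" .
  qed
  have "endofunctor C Fo Fa"
    unfolding endofunctor_def using o Id Comp Fa by blast
  moreover have "Fo ` Obj C \<subseteq> S" using cS by blast
  ultimately have "right_adjoint_to_inclusion C S Fo Fa"
    unfolding right_adjoint_to_inclusion_def
    using Fa cH c unfolding coreflection_def by (intro conjI exI[of _ c]) blast+
  then show ?thesis using FX by blast
qed

end

context triangulated_category
begin

lemma coreflection_Sh: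
  assumes e: "coreflection C S X A e" and S: "S \<subseteq> Obj C"
  shows "coreflection C (ShO C k ` S) (ShO C k X) (ShO C k A) (ShA C k e)"
proof (rule coreflectionI)
  note A = coreflectionD[OF e]
  have o: "X \<in> Obj C" "A \<in> Obj C" using Hom_Obj A by blast+
  show "ShO C k A \<in> ShO C k ` S" using A by blast
  show eH: "ShA C k e \<in> Hom C (ShO C k A) (ShO C k X)" using A ShA_Hom by blast
  show "ShA C k e \<cdot> v \<in> Hom C B (ShO C k X)" if "v \<in> Hom C B (ShO C k A)" for B v
    using Comp_Hom that eH by blast
  fix B' u assume "B' \<in> ShO C k ` S" and u: "u \<in> Hom C B' (ShO C k X)"
  then obtain B where B: "B \<in> S" "B' = ShO C k B" by blast
  have oB: "B \<in> Obj C" using B S by blast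
  have "ShA C (- k) u \<in> Hom C B X" using ShA_Hom[OF u, of "- k"] B o oB by (simp add: ShO_cancel)
  then obtain v where v: "v \<in> Hom C B A" "e \<cdot> v = ShA C (- k) u"
    and v': "\<And>w. w \<in> Hom C B A \<Longrightarrow> e \<cdot> w = ShA C (- k) u \<Longrightarrow> w = v"
    using coreflection_factor[OF e B(1)] by blast
  show "\<exists>!v. v \<in> Hom C B' (ShO C k A) \<and> ShA C k e \<cdot> v = u"
  proof (rule ex1I[of _ "ShA C k v"])
    show "ShA C k v \<in> Hom C B' (ShO C k A) \<and> ShA C k e \<cdot> ShA C k v = u"
      using ShA_Hom[OF v(1)] B ShA_Comp[OF v(1) A(2), of k] v(2) ShA_cancel(1)[OF u] by simp
    fix w assume w: "w \<in> Hom C B' (ShO C k A) \<and> ShA C k e \<cdot> w = u"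
    have wH: "ShA C (- k) w \<in> Hom C B A"
      using ShA_Hom[OF conjunct1[OF w], of "- k"] B o oB by (simp add: ShO_cancel)
    have "e \<cdot> ShA C (- k) w = ShA C (- k) u"
      using ShA_Comp[OF conjunct1[OF w] eH, of "- k"] w ShA_cancel(2)[OF A(2)] by simp
    then have "ShA C (- k) w = v" using v' wH by blast
    then show "w = ShA C k v" using ShA_cancel(1)[OF conjunct1[OF w], of k] by simp
  qed
qed

text \<open>An arrow into \<open>A\<close> killed by \<open>f\<close> factors, after a shift by one, through an arrow from \<open>W[1]\<close>
  to the cone \<open>B\<close>.\<close>

lemma fibre_postcomp_injective:
  assumes t: "f \<in> Hom C A X" "g \<in> Hom C X B" "h \<in> Hom C B (ShO C 1 A)" "(f, g, h) \<in> Dist C"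
    and W: "W \<in> Obj C" "Hom C (ShO C 1 W) B = {Zero C (ShO C 1 W) B}"
    and v: "v \<in> Hom C W A" "w \<in> Hom C W A" "f \<cdot> v = f \<cdot> w"
  shows "v = w"
proof (rule postcomp_cancel[OF t(1) v])
  fix d assume d: "d \<in> Hom C W A" "f \<cdot> d = Zero C W X"
  let ?f = "ShA C 1 f" and ?d = "ShA C 1 d"
  have o: "A \<in> Obj C" "X \<in> Obj C" "B \<in> Obj C" "ShO C 1 W \<in> Obj C"
    using Hom_Obj t ShO_Obj W by blast+
  have f1: "?f \<in> Hom C (ShO C 1 A) (ShO C 1 X)" and d1: "?d \<in> Hom C (ShO C 1 W) (ShO C 1 A)"
    using ShA_Hom t d by blast+
  have "?f \<cdot> ?d = Zero C (ShO C 1 W) (ShO C 1 X)"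
    using ShA_Comp[OF d(1) t(1), of 1] d(2) ShA_Zero W o by simp
  then have "Neg C ?f \<cdot> ?d = Zero C (ShO C 1 W) (ShO C 1 X)"
    using Neg_Comp[OF d1 f1] Neg_Zero o ShO_Obj by simp
  then obtain s where "s \<in> Hom C (ShO C 1 W) B" "?d = h \<cdot> s"
    using factor_through_fibre[OF t(3) Neg_Hom[OF f1] Neg_Hom[OF ShA_Hom[OF t(2)]]
      rotate_triangle[OF t(2,3) Neg_Hom[OF f1] rotate_triangle[OF t]] d1] by blast
  then have "?d = Zero C (ShO C 1 W) (ShO C 1 A)" using W Comp_Zero[OF t(3) o(4)] by simp
  then show "d = Zero C W A" using ShA_eq_Zero d by blast
qed

lemma coreflection_triangle:
  assumes t: "f \<in> Hom C A X" "g \<in> Hom C X B" "h \<in> Hom C B (ShO C 1 A)" "(f, g, h) \<in> Dist C"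
    and S: "S \<subseteq> Obj C" "ShO C 1 ` S \<subseteq> S" "A \<in> S"
    and orth: "\<And>W. W \<in> S \<Longrightarrow> Hom C W B = {Zero C W B}"
  shows "coreflection C S X A f"
proof (rule coreflectionI[OF S(3) t(1)])
  show "f \<cdot> v \<in> Hom C W X" if "v \<in> Hom C W A" for W v using Comp_Hom that t by blast
  fix W u assume W: "W \<in> S" and u: "u \<in> Hom C W X"
  have "g \<cdot> u = Zero C W B" using Comp_Hom[OF u t(2)] orth[OF W] by blast
  then obtain v where v: "v \<in> Hom C W A" "u = f \<cdot> v" using factor_through_fibre[OF t u] by blast
  have W1: "W \<in> Obj C" "Hom C (ShO C 1 W) B = {Zero C (ShO C 1 W) B}" using W S orth by blast+
  have inj: "v = w" if "w \<in> Hom C W A" "f \<cdot> v = f \<cdot> w" for w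
    using fibre_postcomp_injective[OF t W1 v(1) that] .
  show "\<exists>!v. v \<in> Hom C W A \<and> f \<cdot> v = u"
  proof (rule ex1I[of _ v])
    show "v \<in> Hom C W A \<and> f \<cdot> v = u" using v by simp
    show "w = v" if "w \<in> Hom C W A \<and> f \<cdot> w = u" for w using inj[of w] that v(2) by simp
  qed
qed

end


section \<open>t-structures\<close>

context triangulated_category
begin

lemma mem_Sh_image_iff:
  assumes "P \<subseteq> Obj C" "X \<in> Obj C"
  shows "X \<in> ShO C (- i) ` P \<longleftrightarrow> ShO C i X \<in> P"
proof
  assume "X \<in> ShO C (- i) ` P"
  then show "ShO C i X \<in> P" using assms ShO_cancel(1) by auto
next
  assume "ShO C i X \<in> P"
  then show "X \<in> ShO C (- i) ` P" using assms by (intro image_eqI[of _ _ "ShO C i X"]) (simp add: ShO_cancel)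
qed

lemma t_structureD:
  assumes "t_structure C E"
  shows "full_additive_subcategory C (aisle E)" "full_additive_subcategory C (coaisle E)"
    "aisle E \<subseteq> Obj C" "coaisle E \<subseteq> Obj C" "le C E 0 \<subseteq> le C E 1" "ge C E 1 \<subseteq> ge C E 0"
    "nondegenerate C E"
proof -
  show "full_additive_subcategory C (aisle E)" "full_additive_subcategory C (coaisle E)"
    "le C E 0 \<subseteq> le C E 1" "ge C E 1 \<subseteq> ge C E 0" "nondegenerate C E"
    using assms unfolding t_structure_def by - (elim conjE, assumption)+
  then show "aisle E \<subseteq> Obj C" "coaisle E \<subseteq> Obj C"
    unfolding full_additive_subcategory_def by - (elim conjE, assumption)+
qed

context
  fixes E
  assumes E: "t_structure C E"
begin

lemma le_Obj: "le C E i \<subseteq> Obj C"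
  using t_structureD(3)[OF E] ShO_Obj unfolding le_def by blast

lemma ge_Obj: "ge C E i \<subseteq> Obj C"
  using t_structureD(4)[OF E] ShO_Obj unfolding ge_def by blast

lemma Sh_mem_le: "X \<in> Obj C \<Longrightarrow> ShO C k X \<in> le C E i \<longleftrightarrow> X \<in> le C E (i + k)"
  using mem_Sh_image_iff[OF t_structureD(3)[OF E], of "ShO C k X" i]
    mem_Sh_image_iff[OF t_structureD(3)[OF E], of X "i + k"] ShO_Obj[of X k]
  unfolding le_def by (simp only: ShO_ShO)

lemma Sh_mem_ge: "X \<in> Obj C \<Longrightarrow> ShO C k X \<in> ge C E i \<longleftrightarrow> X \<in> ge C E (i + k)"
  using mem_Sh_image_iff[OF t_structureD(4)[OF E], of "ShO C k X" i]
    mem_Sh_image_iff[OF t_structureD(4)[OF E], of X "i + k"] ShO_Obj[of X k]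
  unfolding ge_def by (simp only: ShO_ShO)

lemma le_0: "le C E 0 = aisle E"
  using t_structureD(3)[OF E] ShO_0 unfolding le_def by (force simp: image_def)

lemma ge_0: "ge C E 0 = coaisle E"
  using t_structureD(4)[OF E] ShO_0 unfolding ge_def by (force simp: image_def)

lemma Sh_le: "ShO C k ` le C E i = le C E (i - k)"
proof -
  have "ShO C k ` le C E i = (\<lambda>X. ShO C k (ShO C (- i) X)) ` aisle E" by (simp add: le_def image_image)
  also have "\<dots> = ShO C (- (i - k)) ` aisle E"
    using t_structureD(3)[OF E] by (intro image_cong) (auto simp: ShO_ShO)
  finally show ?thesis by (simp add: le_def)
qed

lemma Sh_ge: "ShO C k ` ge C E i = ge C E (i - k)"
proof -
  have "ShO C k ` ge C E i = (\<lambda>X. ShO C k (ShO C (- i) X)) ` coaisle E" by (simp add: ge_def image_image)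
  also have "\<dots> = ShO C (- (i - k)) ` coaisle E"
    using t_structureD(4)[OF E] by (intro image_cong) (auto simp: ShO_ShO)
  finally show ?thesis by (simp add: ge_def)
qed

lemma le_Suc: "le C E i \<subseteq> le C E (i + 1)"
  using image_mono[OF t_structureD(5)[OF E], of "ShO C (- i)"] by (simp add: Sh_le add.commute)

lemma ge_Suc: "ge C E (i + 1) \<subseteq> ge C E i"
  using image_mono[OF t_structureD(6)[OF E], of "ShO C (- i)"] by (simp add: Sh_ge add.commute)

lemma le_mono: "i \<le> j \<Longrightarrow> le C E i \<subseteq> le C E j"
  by (induction j rule: int_ge_induct) (use le_Suc in blast)+

lemma ge_antimono: "i \<le> j \<Longrightarrow> ge C E j \<subseteq> ge C E i"
  by (induction j rule: int_ge_induct) (use ge_Suc in blast)+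

lemma Hom_le_ge:
  assumes X: "X \<in> le C E i" and Y: "Y \<in> ge C E j" and ij: "i < j"
  shows "Hom C X Y = {Zero C X Y}"
proof -
  have o: "X \<in> Obj C" "Y \<in> Obj C" using X Y le_Obj ge_Obj by blast+
  have "ShO C i X \<in> le C E 0" "ShO C i Y \<in> ge C E 1"
    using o X Y Sh_mem_le Sh_mem_ge ge_antimono[of "i + 1" j] ij by (auto simp: add.commute)
  then have "Hom C (ShO C i X) (ShO C i Y) = {Zero C (ShO C i X) (ShO C i Y)}"
    using E unfolding t_structure_def by blast
  then show ?thesis using Hom_Sh_trivial[of "ShO C i X" "ShO C i Y" "- i"] o
    by (simp add: ShO_cancel ShO_Obj)
qed

lemma truncation_triangle:
  assumes X: "X \<in> Obj C"
  obtains A B f g h where "A \<in> le C E k" "B \<in> ge C E (k + 1)" "f \<in> Hom C A X" "g \<in> Hom C X B"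
    "h \<in> Hom C B (ShO C 1 A)" "(f, g, h) \<in> Dist C"
proof -
  obtain A B f g h where AB: "A \<in> le C E 0" "B \<in> ge C E 1"
    and t: "f \<in> Hom C A (ShO C k X)" "g \<in> Hom C (ShO C k X) B" "h \<in> Hom C B (ShO C 1 A)" "(f, g, h) \<in> Dist C"
    using E ShO_Obj[OF X, of k] unfolding t_structure_def by meson
  have "ShO C (- k) A \<in> le C E k" "ShO C (- k) B \<in> ge C E (k + 1)"
    using AB le_Obj ge_Obj by (subst Sh_mem_le Sh_mem_ge; auto)+
  then show ?thesis using that shift_triangle[OF t, of "- k"] X by (auto simp: ShO_cancel)
qed

lemma coreflection_truncation:
  assumes "f \<in> Hom C A X" "g \<in> Hom C X B" "h \<in> Hom C B (ShO C 1 A)" "(f, g, h) \<in> Dist C"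
    and "A \<in> le C E k" "B \<in> ge C E (k + 1)"
  shows "coreflection C (le C E k) X A f"
  by (rule coreflection_triangle[OF assms(1-4)])
    (use assms le_Obj Hom_le_ge[of _ k B "k + 1"] Sh_le[of 1 k] le_mono[of "k - 1" k] in auto)

lemma ex_coreflection_le:
  assumes "X \<in> Obj C"
  shows "\<exists>A e. coreflection C (le C E k) X A e"
  using truncation_triangle[OF assms] coreflection_truncation by metis

lemma le_iso:
  assumes "X \<in> le C E k" "isomorphic C X Y"
  shows "Y \<in> le C E k"
proof -
  have o: "X \<in> Obj C" "Y \<in> Obj C" using assms(2) Hom_Obj unfolding isomorphic_def by blast+
  have "ShO C k X \<in> aisle E" using assms Sh_mem_le[OF o(1), of k 0] le_0 by simp
  then have "ShO C k Y \<in> aisle E"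
    using isomorphic_Sh[OF assms(2)] t_structureD(1)[OF E] ShO_Obj o
    unfolding full_additive_subcategory_def by blast
  then show ?thesis using Sh_mem_le[OF o(2), of k 0] le_0 by simp
qed

lemma ge_iso:
  assumes "X \<in> ge C E k" "isomorphic C X Y"
  shows "Y \<in> ge C E k"
proof -
  have o: "X \<in> Obj C" "Y \<in> Obj C" using assms(2) Hom_Obj unfolding isomorphic_def by blast+
  have "ShO C k X \<in> coaisle E" using assms Sh_mem_ge[OF o(1), of k 0] ge_0 by simp
  then have "ShO C k Y \<in> coaisle E"
    using isomorphic_Sh[OF assms(2)] t_structureD(2)[OF E] ShO_Obj o
    unfolding full_additive_subcategory_def by blast
  then show ?thesis using Sh_mem_ge[OF o(2), of k 0] ge_0 by simp
qed

text \<open>If all arrows from \<open>X\<close> to the coaisle vanish, then so does \<open>X \<rightarrow> B\<close> in the truncation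
  triangle \<open>A \<rightarrow> X \<rightarrow> B\<close>. Hence \<open>A \<rightarrow> X\<close> has a section, which is also a retraction
  because \<open>A \<rightarrow> X\<close> is a monomorphism with respect to arrows from the aisle.\<close>

lemma le_iff_orthogonal:
  "X \<in> le C E k \<longleftrightarrow> X \<in> Obj C \<and> (\<forall>Z \<in> ge C E (k + 1). Hom C X Z = {Zero C X Z})"
proof (intro iffI conjI ballI)
  show "X \<in> Obj C" if "X \<in> le C E k" using that le_Obj by blast
  show "Hom C X Z = {Zero C X Z}" if "X \<in> le C E k" "Z \<in> ge C E (k + 1)" for Z
    using Hom_le_ge that by simp
next
  assume X: "X \<in> Obj C \<and> (\<forall>Z \<in> ge C E (k + 1). Hom C X Z = {Zero C X Z})"
  then obtain A B f g h where A: "A \<in> le C E k" and B: "B \<in> ge C E (k + 1)"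
    and t: "f \<in> Hom C A X" "g \<in> Hom C X B" "h \<in> Hom C B (ShO C 1 A)" "(f, g, h) \<in> Dist C"
    using truncation_triangle by blast
  have o: "A \<in> Obj C" "X \<in> Obj C" using Hom_Obj t by blast+
  have "g = Zero C X B" using X B t by blast
  then have "g \<cdot> Id C X = Zero C X B" using Comp_Id t by simp
  then obtain s where s: "s \<in> Hom C X A" "Id C X = f \<cdot> s"
    using factor_through_fibre[OF t Id_Hom[OF o(2)]] by blast
  have "f \<cdot> (s \<cdot> f) = f \<cdot> Id C A"
    using Comp_assoc[OF t(1) s(1) t(1)] s Comp_Id[OF t(1)] Id_Comp[OF t(1)] by simp
  moreover have "Hom C (ShO C 1 A) B = {Zero C (ShO C 1 A) B}"
    using Hom_le_ge[OF _ B, of "ShO C 1 A" "k - 1"] A Sh_mem_le[OF o(1), of 1 "k - 1"] by simp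
  ultimately have "s \<cdot> f = Id C A"
    using fibre_postcomp_injective[OF t o(1)] Comp_Hom[OF t(1) s(1)] Id_Hom[OF o(1)] by blast
  then have "isomorphic C A X" using isomorphicI[OF t(1) s(1)] s by simp
  then show "X \<in> le C E k" using le_iso A by blast
qed

text \<open>Dually, \<open>Y \<rightarrow> B\<close> has a retraction \<open>s\<close>. The difference of \<open>g \<cdot> s\<close> and the identity of \<open>B\<close> is
  killed by \<open>g\<close>, so it factors through an arrow from \<open>A[1]\<close> to \<open>B\<close>, which is zero for degree
  reasons.\<close>

lemma ge_iff_orthogonal:
  "Y \<in> ge C E (k + 1) \<longleftrightarrow> Y \<in> Obj C \<and> (\<forall>W \<in> le C E k. Hom C W Y = {Zero C W Y})"
proof (intro iffI conjI ballI)
  show "Y \<in> Obj C" if "Y \<in> ge C E (k + 1)" using that ge_Obj by blast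
  show "Hom C W Y = {Zero C W Y}" if "Y \<in> ge C E (k + 1)" "W \<in> le C E k" for W
    using Hom_le_ge that by simp
next
  assume Y: "Y \<in> Obj C \<and> (\<forall>W \<in> le C E k. Hom C W Y = {Zero C W Y})"
  then obtain A B f g h where A: "A \<in> le C E k" and B: "B \<in> ge C E (k + 1)"
    and t: "f \<in> Hom C A Y" "g \<in> Hom C Y B" "h \<in> Hom C B (ShO C 1 A)" "(f, g, h) \<in> Dist C"
    using truncation_triangle by blast
  have o: "B \<in> Obj C" "Y \<in> Obj C" "A \<in> Obj C" using Hom_Obj t by blast+
  have f1: "ShA C 1 f \<in> Hom C (ShO C 1 A) (ShO C 1 Y)" using ShA_Hom t by blast
  have "f = Zero C A Y" using Y A t by blast
  then have "Id C Y \<cdot> f = Zero C A Y" using Id_Comp t by simp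
  then obtain s where s: "s \<in> Hom C B Y" "Id C Y = s \<cdot> g"
    using factor_through_cone[OF t(1,2,4) Id_Hom[OF o(2)]] by blast
  have gs: "(g \<cdot> s) \<cdot> g = Id C B \<cdot> g"
    using Comp_assoc[OF t(2) s(1) t(2)] s Comp_Id[OF t(2)] Id_Comp[OF t(2)] by simp
  have "g \<cdot> s = Id C B"
  proof (rule precomp_cancel[OF t(2) Comp_Hom[OF s(1) t(2)] Id_Hom[OF o(1)] gs])
    fix d assume "d \<in> Hom C B B" "d \<cdot> g = Zero C Y B"
    then obtain r where "r \<in> Hom C (ShO C 1 A) B" "d = r \<cdot> h"
      using factor_through_cone[OF t(2,3) rotate_triangle[OF t]] by blast
    moreover have "Hom C (ShO C 1 A) B = {Zero C (ShO C 1 A) B}"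
      using Hom_le_ge[OF _ B, of "ShO C 1 A" "k - 1"] A Sh_mem_le[OF o(3), of 1 "k - 1"] by simp
    ultimately show "d = Zero C B B" using Zero_Comp[OF t(3) o(1)] by simp
  qed
  then have "isomorphic C B Y" using isomorphicI[OF s(1) t(2)] s by simp
  then show "Y \<in> ge C E (k + 1)" using ge_iso B by blast
qed

lemma coaisle_eq: "coaisle E = {Y \<in> Obj C. \<forall>W \<in> le C E (- 1). Hom C W Y = {Zero C W Y}}"
  using ge_iff_orthogonal[of _ "- 1"] ge_0 by auto

text \<open>An arrow from \<open>B\<close> to the coaisle vanishes on \<open>X\<close>, so it factors through \<open>A[1]\<close>, where it
  vanishes too.\<close>

lemma le_cone:
  assumes t: "f \<in> Hom C A X" "g \<in> Hom C X B" "h \<in> Hom C B (ShO C 1 A)" "(f, g, h) \<in> Dist C"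
    and AX: "A \<in> le C E k" "X \<in> le C E k"
  shows "B \<in> le C E k"
  unfolding le_iff_orthogonal[of B]
proof (intro conjI ballI)
  have o: "A \<in> Obj C" "X \<in> Obj C" "B \<in> Obj C" using t Hom_Obj by blast+
  show "B \<in> Obj C" by (rule o)
  fix Z assume Z: "Z \<in> ge C E (k + 1)"
  then have oZ: "Z \<in> Obj C" using ge_Obj by blast
  have "u = Zero C B Z" if u: "u \<in> Hom C B Z" for u
  proof -
    have "u \<cdot> g = Zero C X Z" using Hom_le_ge[OF AX(2) Z] Comp_Hom[OF t(2) u] by simp
    then obtain s where s: "s \<in> Hom C (ShO C 1 A) Z" "u = s \<cdot> h"
      using factor_through_cone[OF t(2,3) rotate_triangle[OF t] u] by blast
    have "ShO C 1 A \<in> le C E (k - 1)" using Sh_mem_le[OF o(1), of 1 "k - 1"] AX by simp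
    then have "s = Zero C (ShO C 1 A) Z" using Hom_le_ge[OF _ Z, of _ "k - 1"] s by auto
    then show ?thesis using s Zero_Comp[OF t(3) oZ] by simp
  qed
  then show "Hom C B Z = {Zero C B Z}" using Zero_Hom[OF o(3) oZ] by blast
qed

lemma le_shifted: "le C \<lparr>aisle = le C E j, coaisle = ge C E j\<rparr> i = le C E (i + j)"
  using Sh_le[of "- i" j] by (simp add: le_def[of C "\<lparr>aisle = _, coaisle = _\<rparr>"] add.commute)

lemma ge_shifted: "ge C \<lparr>aisle = le C E j, coaisle = ge C E j\<rparr> i = ge C E (i + j)"
  using Sh_ge[of "- i" j] by (simp add: ge_def[of C "\<lparr>aisle = _, coaisle = _\<rparr>"] add.commute)

end

lemma full_additive_subcategory_Sh:
  assumes A: "full_additive_subcategory C A"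
  shows "full_additive_subcategory C (ShO C (- k) ` A)"
proof -
  have o: "A \<subseteq> Obj C" using A unfolding full_additive_subcategory_def by blast
  note a = A[unfolded full_additive_subcategory_def]
  note m = mem_Sh_image_iff[OF o, of _ k]
  show ?thesis unfolding full_additive_subcategory_def
  proof (intro conjI ballI allI impI)
    show o': "ShO C (- k) ` A \<subseteq> Obj C" using o ShO_Obj by blast
    show "Y \<in> ShO C (- k) ` A" if "X \<in> ShO C (- k) ` A" "Y \<in> Obj C" "isomorphic C X Y" for X Y
    proof -
      have "ShO C k X \<in> A" using that m o' by blast
      then have "ShO C k Y \<in> A" using a isomorphic_Sh[OF that(3)] ShO_Obj[OF that(2)] by blast
      then show ?thesis using m that by blast
    qed
    show "Z \<in> ShO C (- k) ` A" if "is_zero_object C Z" for Z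
      using that a is_zero_object_Sh[OF that] m zero_object_Obj[OF that] by blast
    show "S \<in> ShO C (- k) ` A" if "X \<in> ShO C (- k) ` A" "Y \<in> ShO C (- k) ` A" "S \<in> Obj C"
      "is_biproduct C X Y S i j p q" for X Y S i j p q
    proof -
      have "ShO C k X \<in> A" "ShO C k Y \<in> A" using that m o' by blast+
      then have "ShO C k S \<in> A" using a is_biproduct_Sh[OF that(4)] ShO_Obj[OF that(3)] by blast
      then show ?thesis using m that by blast
    qed
  qed
qed

lemma t_structure_shifted:
  assumes E: "t_structure C E"
  shows "t_structure C \<lparr>aisle = le C E j, coaisle = ge C E j\<rparr>"
proof -
  note l = le_shifted[OF E] and g = ge_shifted[OF E]
  have "(\<Inter>i. le C E (i + j)) = (\<Inter>i. le C E i)" "(\<Inter>i. ge C E (i + j)) = (\<Inter>i. ge C E i)"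
    using bij_betw_imp_surj_on[OF bij_plus_right[of j]] by (metis image_image)+
  then have nd: "nondegenerate C \<lparr>aisle = le C E j, coaisle = ge C E j\<rparr>"
    using t_structureD(7)[OF E] unfolding nondegenerate_def l g by simp
  have "\<exists>A \<in> le C E j. \<exists>B \<in> ge C E (1 + j). \<exists>f g h. f \<in> Hom C A X \<and> g \<in> Hom C X B \<and>
      h \<in> Hom C B (ShO C 1 A) \<and> (f, g, h) \<in> Dist C" if X: "X \<in> Obj C" for X
  proof -
    obtain A B f g h where "A \<in> le C E j" "B \<in> ge C E (1 + j)" "f \<in> Hom C A X" "g \<in> Hom C X B"
      "h \<in> Hom C B (ShO C 1 A)" "(f, g, h) \<in> Dist C"
      using truncation_triangle[OF E X, of j] by (metis add.commute)
    then show ?thesis by blast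
  qed
  moreover have "full_additive_subcategory C (le C E j)" "full_additive_subcategory C (ge C E j)"
    using full_additive_subcategory_Sh t_structureD(1,2)[OF E] unfolding le_def ge_def by blast+
  moreover have "le C E j \<subseteq> le C E (1 + j)" "ge C E (1 + j) \<subseteq> ge C E j"
    using le_mono[OF E, of j "1 + j"] ge_antimono[OF E, of j "1 + j"] by simp_all
  moreover have "\<forall>X \<in> le C E j. \<forall>Y \<in> ge C E (1 + j). Hom C X Y = {Zero C X Y}"
    using Hom_le_ge[OF E, of _ j _ "1 + j"] by simp
  ultimately show ?thesis using nd unfolding t_structure_def l g by simp
qed

text \<open>The coaisle is the right orthogonal of the shifted aisle.\<close>

lemma t_structure_eqI:
  assumes E: "t_structure C E" and E': "t_structure C E'" and "aisle E = aisle E'"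
  shows "E = E'"
  using assms coaisle_eq[OF E] coaisle_eq[OF E'] by (cases E; cases E') (simp add: le_def)

end


section \<open>Left compatibility\<close>

context triangulated_category
begin

context
  fixes D T
  assumes D: "t_structure C D" and T: "t_structure C T"
begin

text \<open>Left compatibility can be tested on single coreflections: every coreflection is a value of
  some truncation functor, and every value is a coreflection.\<close>

lemma left_compatible_iff:
  "left_compatible C D T \<longleftrightarrow>
    (\<forall>i X A e. X \<in> le C T 0 \<longrightarrow> coreflection C (le C D i) X A e \<longrightarrow> A \<in> le C T 0)"
proof (intro iffI allI impI)
  fix i X A e
  assume c: "left_compatible C D T" and X: "X \<in> le C T 0" and A: "coreflection C (le C D i) X A e"
  have "X \<in> Obj C" using X le_Obj[OF T] by blast
  then obtain Fo Fa where "right_adjoint_to_inclusion C (le C D i) Fo Fa" "Fo X = A"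
    using ex_right_adjoint[OF ex_coreflection_le[OF D] _ A] by blast
  then show "A \<in> le C T 0" using c X unfolding left_compatible_def truncation_functor_def by blast
next
  assume c: "\<forall>i X A e. X \<in> le C T 0 \<longrightarrow> coreflection C (le C D i) X A e \<longrightarrow> A \<in> le C T 0"
  show "left_compatible C D T"
    unfolding left_compatible_def truncation_functor_def
    using right_adjoint_coreflection c le_Obj[OF T] by blast
qed

lemma left_compatible_le:
  assumes c: "left_compatible C D T" and X: "X \<in> le C T k" and A: "coreflection C (le C D i) X A e"
  shows "A \<in> le C T k"
proof -
  have o: "X \<in> Obj C" "A \<in> Obj C" using Hom_Obj coreflectionD(2)[OF A] by blast+
  have "coreflection C (le C D (i - k)) (ShO C k X) (ShO C k A) (ShA C k e)"
    using coreflection_Sh[OF A le_Obj[OF D], of k] Sh_le[OF D] by simp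
  moreover have "ShO C k X \<in> le C T 0" using Sh_mem_le[OF T o(1), of k 0] X by simp
  ultimately have "ShO C k A \<in> le C T 0" using c left_compatible_iff by blast
  then show ?thesis using Sh_mem_le[OF T o(2), of k 0] by simp
qed

context
  fixes n :: nat
  assumes filterable: "left_filterable C D T"
begin

text \<open>Filterability gives the t-structure with aisle \<open>D\<^sup>\<le>\<^sup>-\<^sup>m \<inter> T\<^sup>\<le>\<^sup>0\<close> for \<open>m = n - i\<close>; its shift by
  \<open>-m\<close> has the required aisle.\<close>

lemma left_basic:
  shows t_structure_left_basic: "t_structure C (left_basic C D T n i)"
    and aisle_left_basic: "aisle (left_basic C D T n i) = le C D 0 \<inter> le C T (int n - int i)"
proof -
  let ?m = "int n - int i"
  obtain E where E: "t_structure C E" and aE: "aisle E = le C D (- ?m) \<inter> le C T 0"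
    using filterable unfolding left_filterable_def by blast
  have "X \<in> le C E ?m \<longleftrightarrow> X \<in> le C D 0 \<inter> le C T ?m" if X: "X \<in> Obj C" for X
    using Sh_mem_le[OF E X, of ?m 0] Sh_mem_le[OF D X, of ?m "- ?m"] Sh_mem_le[OF T X, of ?m 0]
      le_0[OF E] aE by simp
  then have a: "le C E ?m = le C D 0 \<inter> le C T ?m"
    using le_Obj[OF E] le_Obj[OF D] by blast
  let ?E = "\<lparr>aisle = le C E ?m, coaisle = ge C E ?m\<rparr>"
  have ex: "t_structure C ?E \<and> aisle ?E = le C D 0 \<inter> le C T ?m"
    using t_structure_shifted[OF E, of ?m] a by simp
  have "\<exists>!E. t_structure C E \<and> aisle E = le C D 0 \<inter> le C T ?m"
    by (rule ex1I[of _ ?E], rule ex) (rule t_structure_eqI, use ex in auto)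
  from theI'[OF this] show "t_structure C (left_basic C D T n i)"
    "aisle (left_basic C D T n i) = le C D 0 \<inter> le C T ?m"
    unfolding left_basic_def by blast+
qed

lemma le_left_basic: "le C (left_basic C D T n i) k = le C D k \<inter> le C T (int n - int i + k)"
proof -
  note B = t_structure_left_basic[of i]
  have "X \<in> le C (left_basic C D T n i) k \<longleftrightarrow> X \<in> le C D k \<inter> le C T (int n - int i + k)"
    if X: "X \<in> Obj C" for X
    using Sh_mem_le[OF B X, of k 0] Sh_mem_le[OF D X, of k 0]
      Sh_mem_le[OF T X, of k "int n - int i"] le_0[OF B] aisle_left_basic by simp
  then show ?thesis using le_Obj[OF B] le_Obj[OF D] by blast
qed

lemma mem_torsion_class_iff:
  "Y \<in> left_basic_torsion_class C D T n i \<longleftrightarrow>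
    Y \<in> le C D 0 \<inter> le C T (int n - int i - 1) \<and>
    (\<forall>W \<in> le C D (- 1) \<inter> le C T (int n - int i - 1). Hom C W Y = {Zero C W Y})"
proof -
  have "le C (left_basic C D T n (i + 1)) 0 = le C D 0 \<inter> le C T (int n - int i - 1)"
    using le_left_basic[of "i + 1" 0] by (simp add: algebra_simps)
  moreover have "le C (left_basic C D T n i) (- 1) = le C D (- 1) \<inter> le C T (int n - int i - 1)"
    using le_left_basic[of i "- 1"] by simp
  moreover have "le C T (int n - int i - 1) \<subseteq> le C T (int n - int i)"
    by (rule le_mono[OF T]) simp
  ultimately show ?thesis
    using le_Obj[OF D, of 0] coaisle_eq[OF t_structure_left_basic[of i]] aisle_left_basic[of i]
    unfolding left_basic_torsion_class_def heart_def by auto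
qed

text \<open>By compatibility, the truncation \<open>A\<close> of \<open>Y\<close> to \<open>D\<^sup>\<le>\<^sup>-\<^sup>1\<close> is itself one of the objects to
  which \<open>Y\<close> is orthogonal, so the counit \<open>A \<rightarrow> Y\<close> is zero.\<close>

lemma torsion_class_subset_heart:
  assumes c: "left_compatible C D T"
  shows "left_basic_torsion_class C D T n i \<subseteq> heart D"
proof
  fix Y assume "Y \<in> left_basic_torsion_class C D T n i"
  then have Y: "Y \<in> le C D 0" "Y \<in> le C T (int n - int i - 1)"
    and orth: "\<And>W. W \<in> le C D (- 1) \<Longrightarrow> W \<in> le C T (int n - int i - 1) \<Longrightarrow> Hom C W Y = {Zero C W Y}"
    using mem_torsion_class_iff by blast+
  have oY: "Y \<in> Obj C" using Y le_Obj[OF D] by blast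
  obtain A e where A: "coreflection C (le C D (- 1)) Y A e"
    using ex_coreflection_le[OF D oY] by blast
  note AD = coreflectionD[OF A]
  have e: "e = Zero C A Y" using orth[OF AD(1) left_compatible_le[OF c Y(2) A]] AD(2) by blast
  have "u = Zero C W Y" if W: "W \<in> le C D (- 1)" and u: "u \<in> Hom C W Y" for W u
    using coreflection_factor[OF A W u] Zero_Comp[OF _ oY] e by metis
  moreover have "Zero C W Y \<in> Hom C W Y" if W: "W \<in> le C D (- 1)" for W
    using Zero_Hom[OF _ oY] W le_Obj[OF D] by blast
  ultimately have "Y \<in> coaisle D" using coaisle_eq[OF D] oY by blast
  then show "Y \<in> heart D" using Y le_0[OF D] unfolding heart_def by simp
qed

text \<open>Membership in the heart of \<open>D\<close> supplies the stronger orthogonality condition needed for the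
  smaller index, and the bound on the \<open>T\<close>-degree only becomes weaker.\<close>

lemma torsion_class_decreasing:
  assumes "left_basic_torsion_class C D T n (i + 1) \<subseteq> heart D"
  shows "left_basic_torsion_class C D T n (i + 1) \<subseteq> left_basic_torsion_class C D T n i"
proof
  fix Y assume Y: "Y \<in> left_basic_torsion_class C D T n (i + 1)"
  then have "Y \<in> coaisle D" using assms unfolding heart_def by blast
  moreover have "Y \<in> le C D 0 \<inter> le C T (int n - int i - 1)"
    using Y le_mono[OF T, of "int n - int (i + 1) - 1" "int n - int i - 1"] mem_torsion_class_iff
    by auto
  ultimately show "Y \<in> left_basic_torsion_class C D T n i"
    using coaisle_eq[OF D] mem_torsion_class_iff by blast
qed

text \<open>The truncation triangle \<open>A \<rightarrow> X \<rightarrow> B\<close> with respect to the left basic t-structure has \<open>B\<close> in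
  its coaisle, and in the next aisle as the cone of an arrow in that aisle. So \<open>B\<close> is in the
  torsion class and therefore in \<open>D\<^sup>\<ge>\<^sup>0\<close>, which makes this triangle the one for \<open>D\<close>.\<close>

lemma truncation_below_heart:
  assumes heart: "left_basic_torsion_class C D T n i \<subseteq> heart D"
    and X: "X \<in> le C D 0" "X \<in> le C T (int n - int i - 1)"
  shows "\<exists>A e. coreflection C (le C D (- 1)) X A e \<and> A \<in> le C T (int n - int i - 1)"
proof -
  let ?E = "left_basic C D T n i" and ?m = "int n - int i - 1"
  note E = t_structure_left_basic[of i]
  have oX: "X \<in> Obj C" using X le_Obj[OF D] by blast
  obtain A B f g h where A: "A \<in> le C ?E (- 1)" and B: "B \<in> ge C ?E 0"
    and t: "f \<in> Hom C A X" "g \<in> Hom C X B" "h \<in> Hom C B (ShO C 1 A)" "(f, g, h) \<in> Dist C"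
    using truncation_triangle[OF E oX, of "- 1" thesis] by simp
  have A': "A \<in> le C D (- 1)" "A \<in> le C T ?m" using A le_left_basic[of i "- 1"] by auto
  have "B \<in> le C D 0" using le_cone[OF D t _ X(1)] A' le_mono[OF D, of "- 1" 0] by auto
  moreover have "B \<in> le C T ?m" by (rule le_cone[OF T t A'(2) X(2)])
  moreover have "Hom C W B = {Zero C W B}" if "W \<in> le C D (- 1) \<inter> le C T ?m" for W
    using Hom_le_ge[OF E _ B, of W "- 1"] that le_left_basic[of i "- 1"] by simp
  ultimately have "B \<in> left_basic_torsion_class C D T n i" using mem_torsion_class_iff by blast
  then have "B \<in> ge C D 0" using heart ge_0[OF D] unfolding heart_def by blast
  then have "coreflection C (le C D (- 1)) X A f" using coreflection_truncation[OF D t A'(1)] by simp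
  then show ?thesis using A' by blast
qed

text \<open>The truncation of \<open>X\<close> in degree \<open>-q-1\<close> is that of \<open>A\<close>, the truncation in degree \<open>-q\<close>. Since
  \<open>A[-q]\<close> lies in \<open>D\<^sup>\<le>\<^sup>0 \<inter> T\<^sup>\<le>\<^sup>q\<close>, its truncation in degree \<open>-1\<close> stays in \<open>T\<^sup>\<le>\<^sup>q\<close> by the
  hypothesis for the index \<open>i\<close> with \<open>n - i - 1 = q\<close>.\<close>

lemma left_compatible_if_torsion_classes_in_heart:
  assumes type: "of_type C D T n 0"
    and heart: "\<And>i. i < n \<Longrightarrow> left_basic_torsion_class C D T n i \<subseteq> heart D"
  shows "left_compatible C D T"
proof -
  have T0: "le C T 0 \<subseteq> le C D 0" and Dn: "le C D (- int n) \<subseteq> le C T 0"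
    using type unfolding of_type_def by blast+
  have neg: "\<exists>A e. coreflection C (le C D (- int q)) X A e \<and> A \<in> le C T 0" if X: "X \<in> le C T 0" for X q
  proof (induction q)
    case 0
    then show ?case using coreflection_Id[of X "le C D 0"] X T0 le_Obj[OF D, of 0] by auto
  next
    case (Suc q)
    then obtain A e where A: "coreflection C (le C D (- int q)) X A e" "A \<in> le C T 0" by blast
    have oA: "A \<in> Obj C" "X \<in> Obj C" using Hom_Obj coreflectionD(2)[OF A(1)] by blast+
    show ?case
    proof (cases "q < n")
      case True
      let ?A = "ShO C (- int q) A" and ?i = "n - 1 - q"
      have m: "int n - int ?i - 1 = int q" using True by simp
      have "?A \<in> le C D 0" "?A \<in> le C T (int q)"
        using Sh_mem_le[OF D oA(1), of "- int q" 0] Sh_mem_le[OF T oA(1), of "- int q" "int q"]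
          coreflectionD(1)[OF A(1)] A(2) by simp_all
      then obtain B d where B: "coreflection C (le C D (- 1)) ?A B d" "B \<in> le C T (int q)"
        using truncation_below_heart[of ?i ?A, unfolded m] heart[of ?i] True by auto
      have oB: "B \<in> Obj C" using B(2) le_Obj[OF T] by blast
      have "coreflection C (le C D (- int (Suc q))) A (ShO C (int q) B) (ShA C (int q) d)"
        using coreflection_Sh[OF B(1) le_Obj[OF D], of "int q"] oA
        by (simp add: Sh_le[OF D] ShO_cancel)
      then have "coreflection C (le C D (- int (Suc q))) X (ShO C (int q) B) (e \<cdot> ShA C (int q) d)"
        using coreflection_trans[OF A(1)] le_mono[OF D, of "- int (Suc q)" "- int q"] by simp
      moreover have "ShO C (int q) B \<in> le C T 0" using Sh_mem_le[OF T oB, of "int q" 0] B(2) by simp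
      ultimately show ?thesis by blast
    next
      case False
      obtain B d where B: "coreflection C (le C D (- int (Suc q))) X B d"
        using ex_coreflection_le[OF D oA(2)] by blast
      have "le C D (- int (Suc q)) \<subseteq> le C D (- int n)" using False by (intro le_mono[OF D]) simp
      then show ?thesis using B coreflectionD(1)[OF B] Dn by blast
    qed
  qed
  show ?thesis unfolding left_compatible_iff
  proof (intro allI impI)
    fix i X A e
    assume X: "X \<in> le C T 0" and A: "coreflection C (le C D i) X A e"
    have "\<exists>B d. coreflection C (le C D i) X B d \<and> B \<in> le C T 0"
    proof (cases "i \<le> 0")
      case True
      then show ?thesis using neg[OF X, of "nat (- i)"] by simp
    next
      case False
      then have "X \<in> le C D i" using X T0 le_mono[OF D, of 0 i] by auto
      then show ?thesis using coreflection_Id X le_Obj[OF D] by blast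
    qed
    then obtain B d where B: "coreflection C (le C D i) X B d" "B \<in> le C T 0" by blast
    show "A \<in> le C T 0" by (rule le_iso[OF T B(2) coreflection_unique[OF B(1) A]])
  qed
qed

end

end

end


section \<open>The characterisation of left compatibility\<close>

theorem theorem6p13:
  fixes C :: "('o, 'm) triangulated" and D T :: "'o t_struct" and n :: nat
  assumes "triangulated_category C"
    and "t_structure C D" and "t_structure C T"
    and "left_filterable C D T"
    and "of_type C D T n 0"
  shows "(left_compatible C D T \<longleftrightarrow>
      (\<forall>i<n. left_basic_torsion_class C D T n i \<subseteq> heart D)) \<and>
    (left_compatible C D T \<longrightarrow>
      (\<forall>i. i + 1 < n \<longrightarrow>
        left_basic_torsion_class C D T n (i + 1) \<subseteq> left_basic_torsion_class C D T n i) \<and>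
      (0 < n \<longrightarrow> left_basic_torsion_class C D T n 0 \<subseteq> heart D))"
proof -
  interpret triangulated_category C by fact
  note DT = assms(2-4)
  show ?thesis
    using torsion_class_subset_heart[OF DT] torsion_class_decreasing[OF DT]
      left_compatible_if_torsion_classes_in_heart[OF DT assms(5)] by meson
qed

end
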